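(* Let $q$ be a power of an odd prime, and let $E$ be an elliptic curve over $\mathbb{F}_q$. Let $a=1+q-\#E(\mathbb{F}_q)$. Then for each integer $m\ge1$ the coefficient (in $\mathbb{Z}/2\mathbb{Z}$) of $\varepsilon t^{m-1}$ in $\mathrm{dlog}\,\zeta^{\mathbb{A}^1}_E$ is as follows, according to $(a,q)\bmod 4$: - $(0,1)$: it is $1$ if and only if $m\in\{4k+2\}_{k\ge0}$; - $(0,3)$: it is $0$ for all $m$; - $(1,1)$: it is $1$ if and only if $m\in\{6k+2,6k+4\}_{k\ge0}$; - $(1,3)$: it is $1$ if and only if $m\in\{6k+4\}_{k\ge0}$; - $(2,1)$: it is $0$ for all $m$; - $(2,3)$: it is $1$ if and only if $m\in\{4k+2\}_{k\ge0}$; - $(3,1)$: it is $0$ for all $m$; - $(3,3)$: it is $1$ if and only if $m\in\{6k+2\}_{k\ge0}$.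
   Context: For $q$ odd, the Grothendieck–Witt ring of $\mathbb{F}_q$ is $\mathrm{GW}(\mathbb{F}_q)=\mathbb{Z}[\langle u\rangle]/(\langle u\rangle^2-1,\ 2\langle u\rangle-2)$, where $u$ is a non-square in $\mathbb{F}_q^\times$ and $\langle 1\rangle=1$. Put $\varepsilon:=-\langle 1\rangle+\langle u\rangle$; then $\varepsilon^2=0$, $2\varepsilon=0$, and $\mathrm{GW}(\mathbb{F}_q)=\mathbb{Z}\oplus(\mathbb{Z}/2\mathbb{Z})\varepsilon$ additively, so that each coefficient of a power series in $\mathrm{GW}(\mathbb{F}_q)[[t]]$ has a well-defined $\varepsilon$-component in $\mathbb{Z}/2\mathbb{Z}$. Let $\mu$ be the Möbius function. For $X$ smooth and proper over $\mathbb{F}_q$, $\mathrm{dlog}\,\zeta^{\mathbb{A}^1}_X\in\mathrm{GW}(\mathbb{F}_q)[[t]]$ is the power series $$\sum_{m=1}^{\infty}\Big(\sum_{i\mid m,\ i\text{ even}}\big(\tfrac1i\sum_{d\mid i}\mu(d)|X(\mathbb{F}_{q^{i/d}})|\big)\big((i-1)\langle 1\rangle+\langle u\rangle\big)+\sum_{i\mid m,\ i\text{ odd}}\big(\tfrac1i\sum_{d\mid i}\mu(d)|X(\mathbb{F}_{q^{i/d}})|\big)\,i\langle 1\rangle\Big)t^{m-1}.$$ *)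

theory Defs
  imports
    "HOL-Computational_Algebra.Computational_Algebra"
    "HOL-Algebra.Algebraic_Closure_Type"
    "HOL-Library.Z2"
    "HOL-Library.Cardinality"
begin

section \<open>The Grothendieck--Witt ring of a finite field of odd order\<close>

text \<open>
  The presentation of $\mathrm{GW}(\mathbb{F}_q)$ for odd $q$ does not depend on $q$: it is
  $\mathbb{Z}[u]/(u^2-1,\,2u-2)$, where the class of $u$ is $\langle u\rangle$.
\<close>

definition gw_ideal :: "int poly set" where
  "gw_ideal = {a * [:-1, 0, 1:] + b * [:-2, 2:] | a b. True}"

lemma gw_ideal_0: "0 \<in> gw_ideal"
  unfolding gw_ideal_def by (intro CollectI exI[of _ 0]) simp

lemma gw_ideal_add: "x \<in> gw_ideal \<Longrightarrow> y \<in> gw_ideal \<Longrightarrow> x + y \<in> gw_ideal"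
proof -
  assume "x \<in> gw_ideal" "y \<in> gw_ideal"
  then obtain a b c d where
    "x = a * [:-1, 0, 1:] + b * [:-2, 2:]" "y = c * [:-1, 0, 1:] + d * [:-2, 2:]"
    unfolding gw_ideal_def by blast
  then have "x + y = (a + c) * [:-1, 0, 1:] + (b + d) * [:-2, 2:]"
    by (simp only: distrib_right ac_simps)
  then show ?thesis unfolding gw_ideal_def by blast
qed

lemma gw_ideal_mult: "x \<in> gw_ideal \<Longrightarrow> r * x \<in> gw_ideal"
proof -
  assume "x \<in> gw_ideal"
  then obtain a b where "x = a * [:-1, 0, 1:] + b * [:-2, 2:]"
    unfolding gw_ideal_def by blast
  then have "r * x = (r * a) * [:-1, 0, 1:] + (r * b) * [:-2, 2:]"
    by (simp only: distrib_left mult.assoc)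
  then show ?thesis unfolding gw_ideal_def by blast
qed

lemma gw_ideal_uminus: "x \<in> gw_ideal \<Longrightarrow> - x \<in> gw_ideal"
  using gw_ideal_mult[of x "-1"] by simp

definition gw_rel :: "int poly \<Rightarrow> int poly \<Rightarrow> bool" where
  "gw_rel p r \<longleftrightarrow> p - r \<in> gw_ideal"

lemma equivp_gw_rel: "equivp gw_rel"
proof (rule equivpI)
  show "reflp gw_rel"
    by (simp add: reflp_def gw_rel_def gw_ideal_0)
  show "symp gw_rel"
  proof (rule sympI)
    fix x y assume "gw_rel x y"
    then show "gw_rel y x"
      using gw_ideal_uminus[of "x - y"] by (simp add: gw_rel_def)
  qed
  show "transp gw_rel"
  proof (rule transpI)
    fix x y z assume "gw_rel x y" "gw_rel y z"
    then show "gw_rel x z"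
      using gw_ideal_add[of "x - y" "y - z"] by (simp add: gw_rel_def)
  qed
qed

quotient_type gw = "int poly" / gw_rel
  by (rule equivp_gw_rel)

instantiation gw :: comm_ring_1
begin

lift_definition zero_gw :: gw is 0 .
lift_definition one_gw :: gw is 1 .

lift_definition plus_gw :: "gw \<Rightarrow> gw \<Rightarrow> gw" is "(+)"
  subgoal for a b c d
    using gw_ideal_add[of "a - b" "c - d"] by (simp add: gw_rel_def algebra_simps)
  done

lift_definition uminus_gw :: "gw \<Rightarrow> gw" is uminus
  subgoal for a b
    using gw_ideal_uminus[of "a - b"] by (simp add: gw_rel_def)
  done

lift_definition minus_gw :: "gw \<Rightarrow> gw \<Rightarrow> gw" is "(-)"
  subgoal for a b c d
    using gw_ideal_add[of "a - b" "- (c - d)"] gw_ideal_uminus[of "c - d"]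
    by (simp add: gw_rel_def algebra_simps)
  done

lift_definition times_gw :: "gw \<Rightarrow> gw \<Rightarrow> gw" is "(*)"
  subgoal for a b c d
    using gw_ideal_add[of "c * (a - b)" "b * (c - d)"]
      gw_ideal_mult[of "a - b" c] gw_ideal_mult[of "c - d" b]
    by (simp add: gw_rel_def algebra_simps)
  done

instance
proof
  fix a b c :: gw
  show "a * b * c = a * (b * c)"
    by transfer (simp add: gw_rel_def gw_ideal_0 mult.assoc)
  show "a * b = b * a"
    by transfer (simp add: gw_rel_def gw_ideal_0 mult.commute)
  show "1 * a = a"
    by transfer (simp add: gw_rel_def gw_ideal_0)
  show "(a + b) * c = a * c + b * c"
    by transfer (simp add: gw_rel_def gw_ideal_0 distrib_right)
  show "a + b + c = a + (b + c)"
    by transfer (simp add: gw_rel_def gw_ideal_0 add.assoc)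
  show "a + b = b + a"
    by transfer (simp add: gw_rel_def gw_ideal_0 add.commute)
  show "0 + a = a"
    by transfer (simp add: gw_rel_def gw_ideal_0)
  show "- a + a = 0"
    by transfer (simp add: gw_rel_def gw_ideal_0)
  show "a - b = a + - b"
    by transfer (simp add: gw_rel_def gw_ideal_0)
  show "(0 :: gw) \<noteq> 1"
  proof (transfer, rule notI)
    assume "gw_rel 0 1"
    then obtain a b where "(0 - 1 :: int poly) = a * [:-1, 0, 1:] + b * [:-2, 2:]"
      unfolding gw_rel_def gw_ideal_def by blast
    then have "poly (0 - 1 :: int poly) 1 = poly (a * [:-1, 0, 1:] + b * [:-2, 2:]) 1"
      by (simp only:)
    then show False by simp
  qed
qed

end

lift_definition gw_u :: gw is "[:0, 1:]" .

definition gw_eps :: gw where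
  "gw_eps = - 1 + gw_u"

lemma gw_u_squared: "gw_u * gw_u = 1"
proof transfer
  have "[:0, 1:] * [:0, 1:] - 1 = 1 * [:-1, 0, 1::int:] + 0 * [:-2, 2:]"
    by (simp add: one_pCons)
  then show "gw_rel ([:0, 1:] * [:0, 1:]) 1"
    unfolding gw_rel_def gw_ideal_def by blast
qed

lemma gw_two_eps: "gw_eps + gw_eps = 0"
  unfolding gw_eps_def
proof transfer
  have "- 1 + [:0, 1:] + (- 1 + [:0, 1:]) - 0 = 0 * [:-1, 0, 1:] + 1 * [:-2, 2::int:]"
    by (simp add: one_pCons)
  then show "gw_rel (- 1 + [:0, 1:] + (- 1 + [:0, 1:])) 0"
    unfolding gw_rel_def gw_ideal_def by blast
qed

lemma gw_eps_squared: "gw_eps * gw_eps = 0"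
proof -
  have "gw_eps * gw_eps = - (gw_eps + gw_eps)"
    by (simp add: gw_eps_def algebra_simps gw_u_squared)
  then show ?thesis by (simp add: gw_two_eps)
qed

text \<open>The $\varepsilon$-component under
  $\mathrm{GW}(\mathbb{F}_q) = \mathbb{Z} \oplus (\mathbb{Z}/2\mathbb{Z})\varepsilon$.\<close>

definition gw_eps_component :: "gw \<Rightarrow> bit" where
  "gw_eps_component x = (THE c. \<exists>n::int. x = of_int n + (if c = 1 then gw_eps else 0))"

lemma of_int_gw: "of_int n = abs_gw [:n:]"
proof -
  have nat: "of_nat k = abs_gw [:int k:]" for k
    by (induction k) (simp_all add: zero_gw.abs_eq one_gw.abs_eq plus_gw.abs_eq one_pCons)
  show ?thesis
    by (cases n rule: int_cases2) (simp_all add: nat uminus_gw.abs_eq)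
qed

lemma gw_decomp_exists: "\<exists>n c. x = of_int n + (if (c::bit) = 1 then gw_eps else 0)"
proof -
  have eps_mult: "gw_u * gw_eps = gw_eps"
    using gw_eps_squared by (simp add: gw_eps_def algebra_simps)
  have "\<exists>n c. abs_gw p = of_int n + (if (c::bit) = 1 then gw_eps else 0)" for p
  proof (induction p)
    case 0
    have "abs_gw 0 = of_int 0 + (if (0::bit) = 1 then gw_eps else 0)"
      by (simp add: zero_gw.abs_eq)
    then show ?case by blast
  next
    case (pCons a p)
    then obtain n and c :: bit where
      IH: "abs_gw p = of_int n + (if c = 1 then gw_eps else 0)" by blast
    have "pCons a p = [:a:] + [:0, 1:] * p" by simp
    then have "abs_gw (pCons a p) = of_int a + gw_u * abs_gw p"
      by (simp only: of_int_gw gw_u.abs_eq plus_gw.abs_eq times_gw.abs_eq)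
    also have "\<dots> = of_int (a + n) + (of_int n * gw_eps + (if c = 1 then gw_eps else 0))"
      using eps_mult by (simp add: IH gw_eps_def algebra_simps)
    also have "of_int n * gw_eps = (if odd n then gw_eps else 0)"
    proof -
      have "of_int n * gw_eps
          = of_int (n div 2) * (gw_eps + gw_eps) + of_int (n mod 2) * gw_eps"
        by (metis (no_types, opaque_lifting) distrib_left distrib_right mult_2_right
            mult_div_mod_eq mult.commute of_int_add)
      then show ?thesis by (simp add: gw_two_eps odd_iff_mod_2_eq_one even_iff_mod_2_eq_zero)
    qed
    also have "(if odd n then gw_eps else 0) + (if c = 1 then gw_eps else 0)
        = (if (of_bool (odd n) + c :: bit) = 1 then gw_eps else 0)"
      by (cases c) (auto simp: gw_two_eps)
    finally show ?case by blast
  qed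
  then show ?thesis by (induction x rule: gw.abs_induct)
qed

lemma gw_decomp_unique:
  assumes "of_int n + (if (c::bit) = 1 then gw_eps else 0)
         = of_int n' + (if c' = 1 then gw_eps else 0)"
  shows "n = n' \<and> c = c'"
proof -
  have eps: "(if e = 1 then gw_eps else 0) = abs_gw (if e = 1 then [:-1, 1:] else 0)" for e :: bit
    by (simp add: gw_eps_def one_gw.abs_eq uminus_gw.abs_eq gw_u.abs_eq plus_gw.abs_eq
        zero_gw.abs_eq one_pCons)
  let ?p = "\<lambda>n (c::bit). [:n:] + (if c = 1 then [:-1, 1:] else 0 :: int poly)"
  have "gw_rel (?p n c) (?p n' c')"
    using assms by (simp only: eps of_int_gw plus_gw.abs_eq gw.abs_eq_iff)
  then obtain a b where ab: "?p n c - ?p n' c' = a * [:-1, 0, 1:] + b * [:-2, 2:]"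
    unfolding gw_rel_def gw_ideal_def by blast
  have "poly (?p n c - ?p n' c') 1 = 0"
    unfolding ab by simp
  then have n: "n = n'" by (simp split: if_splits)
  have "poly (?p n c - ?p n' c') (-1) = - 4 * poly b (- 1)"
    unfolding ab by simp
  then have "(if c = 1 then -2 else 0) - (if c' = 1 then -2 else 0) = - 4 * poly b (- 1)"
    using n by (simp split: if_splits)
  then have "c = c'" by (cases c; cases c') (simp_all, presburger+)
  with n show ?thesis by simp
qed

lemma gw_eps_component_eq:
  "gw_eps_component (of_int n + (if c = 1 then gw_eps else 0)) = c"
  unfolding gw_eps_component_def using gw_decomp_unique by (intro the_equality) blast+

section \<open>The logarithmic derivative of the zeta function\<close>

definition moebius_mu :: "nat \<Rightarrow> int" where
  "moebius_mu n = (if squarefree n then (-1) ^ card (prime_factors n) else 0)"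

text \<open>
  In the next two definitions, \<open>N n\<close> stands for $|X(\mathbb{F}_{q^n})|$. The first one is the number
  of closed points of degree \<open>i\<close> on \<open>X\<close>, so for such \<open>N\<close> the integer division by \<open>i\<close> is exact.
\<close>

definition closed_points :: "(nat \<Rightarrow> nat) \<Rightarrow> nat \<Rightarrow> int" where
  "closed_points N i = (\<Sum>d | d dvd i. moebius_mu d * int (N (i div d))) div int i"

definition dlog_zeta_A1 :: "(nat \<Rightarrow> nat) \<Rightarrow> gw fps" where
  "dlog_zeta_A1 N = Abs_fps (\<lambda>k. let m = Suc k in
     (\<Sum>i | i dvd m \<and> even i. of_int (closed_points N i) * (of_nat (i - 1) * 1 + gw_u)) +
     (\<Sum>i | i dvd m \<and> odd i. of_int (closed_points N i) * (of_nat i * 1)))"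

section \<open>Elliptic curves over a finite field\<close>

text \<open>
  \<open>Weierstrass a1 a2 a3 a4 a6\<close> is the projective plane curve
  $Y^2Z + a_1XYZ + a_3YZ^2 = X^3 + a_2X^2Z + a_4XZ^2 + a_6Z^3$.
\<close>

datatype 'k weierstrass =
  Weierstrass (wa1: 'k) (wa2: 'k) (wa3: 'k) (wa4: 'k) (wa6: 'k)

abbreviation base_change :: "'k::field weierstrass \<Rightarrow> 'k alg_closure weierstrass" where
  "base_change \<equiv> map_weierstrass to_ac"

fun weierstrass_form :: "'k::comm_ring_1 weierstrass \<Rightarrow> 'k \<times> 'k \<times> 'k \<Rightarrow> 'k" where
  "weierstrass_form (Weierstrass a1 a2 a3 a4 a6) (x, y, z) =
     y^2 * z + a1 * x * y * z + a3 * y * z^2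
       - (x^3 + a2 * x^2 * z + a4 * x * z^2 + a6 * z^3)"

text \<open>The partial derivatives with respect to $X$, $Y$ and $Z$.\<close>

fun weierstrass_gradient :: "'k::comm_ring_1 weierstrass \<Rightarrow> 'k \<times> 'k \<times> 'k \<Rightarrow> 'k \<times> 'k \<times> 'k" where
  "weierstrass_gradient (Weierstrass a1 a2 a3 a4 a6) (x, y, z) =
     (a1 * y * z - (3 * x^2 + 2 * a2 * x * z + a4 * z^2),
      2 * y * z + a1 * x * z + a3 * z^2,
      y^2 + a1 * x * y + 2 * a3 * y * z - (a2 * x^2 + 2 * a4 * x * z + 3 * a6 * z^2))"

text \<open>
  Smoothness is required at all geometric points. The rational base point $[0:1:0]$ lies on every
  such curve.
\<close>

definition elliptic_curve :: "'k::field weierstrass \<Rightarrow> bool" where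
  "elliptic_curve E \<longleftrightarrow>
     (\<forall>v. v \<noteq> (0, 0, 0) \<and> weierstrass_form (base_change E) v = 0 \<longrightarrow>
        weierstrass_gradient (base_change E) v \<noteq> (0, 0, 0))"

text \<open>$\mathbb{F}_{q^n}$ inside the algebraic closure of $\mathbb{F}_q$, the latter being the
  type \<open>'a\<close> with \<open>q\<close> elements.\<close>

definition finite_ext :: "nat \<Rightarrow> 'a::{field,finite} alg_closure set" where
  "finite_ext n = {x. x ^ (CARD('a) ^ n) = x}"

text \<open>The point $[x:y:z]$ of $\mathbb{P}^2(K)$, as a class of triples modulo $K^\times$.\<close>

definition proj_point :: "'k::field set \<Rightarrow> 'k \<times> 'k \<times> 'k \<Rightarrow> ('k \<times> 'k \<times> 'k) set" where
  "proj_point K v = (case v of (x, y, z) \<Rightarrow> {(c * x, c * y, c * z) | c. c \<in> K - {0}})"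

definition points ::
  "'a::{field,finite} weierstrass \<Rightarrow> nat \<Rightarrow> ('a alg_closure \<times> 'a alg_closure \<times> 'a alg_closure) set set"
  where
  "points E n = {proj_point (finite_ext n) v | v.
     v \<in> finite_ext n \<times> finite_ext n \<times> finite_ext n \<and> v \<noteq> (0, 0, 0) \<and>
     weierstrass_form (base_change E) v = 0}"

definition dlog_zeta_A1_curve :: "'a::{field,finite} weierstrass \<Rightarrow> gw fps" where
  "dlog_zeta_A1_curve E = dlog_zeta_A1 (\<lambda>n. card (points E n))"

end

theory Submission
  imports Defs
begin

text \<open>
  Let $M_i$ be the number of closed points of degree $i$. For even $i$ the form attached to such a
  point is $(i-1)\langle 1\rangle + \langle u\rangle = i + \varepsilon$, so the wanted coefficient
  is the parity of $\sum_{i \mid m,\ 2 \mid i} M_i$. It is the difference of the sums over all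
  divisors of $m$ and over all divisors of the odd part of $m$, which leaves the parity of
  $B(n) = \sum_{i \mid n} M_i$ to be found.

  The $M_i$ are the exponents of the Euler product $Z(t) = \prod_i (1 - t^i)^{-M_i}$. Since
  $(1 + t^i)/(1 - t^i) = 1 + 2 \sum_{j \ge 1} t^{ij}$, one has
  $Z(t)^2 / Z(t^2) = \prod_i ((1 + t^i)/(1 - t^i))^{M_i} \equiv 1 + 2 \sum_n B(n) t^n$ modulo 4.
  As $Z(t) = (1 - at + qt^2)/((1 - t)(1 - qt))$, the left side depends modulo 4 only on $a$ and $q$
  modulo 4, and its coefficients satisfy a linear recurrence modulo 2 that is periodic of period 4
  or 6 (\<open>lucas_exponents\<close>, \<open>lucas_parity_even\<close>, \<open>lucas_parity_odd\<close>). Exponents exist for every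
  integral power series with constant term 1, and Moebius inversion identifies them with the numbers of
  closed points; in particular it shows that the division by $i$ in the latter is exact.

  The rationality of $Z$ is obtained from character sums. Completing the square turns the curve into
  $y^2 = f(x)$ with $f$ a separable monic cubic. Let $\chi(h)$ be the quadratic character of the
  product of the values of $f$ at the roots of $h$. The sums $S_n$ of $\chi$ over the monic $h$ of
  degree $n$ are the coefficients of the $L$-polynomial, and Newton's identity
  (\<open>newton_identity\<close>) expresses them through the sums of the quadratic character of
  $\mathbb{F}_{q^k}$ over the values of $f$, that is, through the numbers of points. Now $S_n = 0$
  for $n \ge 3$, because $h \mapsto ch + (1 - c) f X^{n-3}$ with $c$ a non-square reverses the sign
  of $\chi$ (\<open>chi_sum_ge_3\<close>), and $S_2 = q$ follows by intersecting the curve with all lines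
  $y = cx + d$ (\<open>char_sum_2\<close>): the number of intersection points that are defined over
  $\mathbb{F}_{q^2}$ is determined by those defined over $\mathbb{F}_q$.
\<close>

section \<open>Parities of the exponents of an Euler product\<close>

text \<open>
  The logarithmic derivative $t\, \mathrm{d}/\mathrm{d}t \log \prod_i (1 - t^i)^{-M_i}$. Its
  coefficients are the numbers of points if the $M_i$ are the numbers of closed points.
\<close>

definition ghost :: "(nat \<Rightarrow> int) \<Rightarrow> int fps" where
  "ghost M = Abs_fps (\<lambda>n. if n = 0 then 0 else \<Sum>i | i dvd n. int i * M i)"

definition orbit_count :: "(nat \<Rightarrow> int) \<Rightarrow> int fps" where
  "orbit_count M = Abs_fps (\<lambda>n. if n = 0 then 0 else \<Sum>i | i dvd n. M i)"

definition sq_arg :: "int fps \<Rightarrow> int fps" where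
  "sq_arg F = F oo fps_X ^ 2"

lemma sq_arg_mult: "sq_arg (F * G) = sq_arg F * sq_arg G"
  by (simp add: sq_arg_def fps_compose_mult_distrib)

lemma sq_arg_1: "sq_arg 1 = 1"
  by (simp add: sq_arg_def)

text \<open>
  The two properties of $F = \prod_i (1 - t^i)^{-M_i}$ that are needed. They make sense for an
  arbitrary family of exponents without forming an infinite product, and both are multiplicative.
\<close>

definition euler_exponents :: "int fps \<Rightarrow> (nat \<Rightarrow> int) \<Rightarrow> bool" where
  "euler_exponents F M \<longleftrightarrow>
     fps_XD F = F * ghost M \<and> 4 dvd F ^ 2 - sq_arg F * (1 + 2 * orbit_count M)"

lemma ghost_add: "ghost (\<lambda>i. M i + M' i) = ghost M + ghost M'"
  by (simp add: ghost_def fps_eq_iff ring_distribs sum.distrib)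

lemma orbit_count_add: "orbit_count (\<lambda>i. M i + M' i) = orbit_count M + orbit_count M'"
  by (simp add: orbit_count_def fps_eq_iff sum.distrib)

lemma ghost_minus: "ghost (\<lambda>i. - M i) = - ghost M"
  by (simp add: ghost_def fps_eq_iff sum_negf)

lemma orbit_count_minus: "orbit_count (\<lambda>i. - M i) = - orbit_count M"
  by (simp add: orbit_count_def fps_eq_iff sum_negf)

lemma euler_exponents_one: "euler_exponents 1 (\<lambda>_. 0)"
proof -
  have "ghost (\<lambda>_. 0) = 0" "orbit_count (\<lambda>_. 0) = 0"
    by (simp_all add: ghost_def orbit_count_def fps_eq_iff)
  then show ?thesis by (simp add: euler_exponents_def fps_XD_def sq_arg_1)
qed

lemma fps_XD_mult: "fps_XD (F * G) = fps_XD F * G + F * (fps_XD G :: int fps)"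
  by (simp add: fps_XD_def algebra_simps)

text \<open>
  Modulo 4, $(1 + 2x)(1 + 2y) = 1 + 2(x + y)$.
\<close>

lemma euler_exponents_mult:
  assumes "euler_exponents F M" "euler_exponents G M'"
  shows "euler_exponents (F * G) (\<lambda>i. M i + M' i)"
proof -
  from assms obtain h k where
    h: "F ^ 2 - sq_arg F * (1 + 2 * orbit_count M) = 4 * h" and
    k: "G ^ 2 - sq_arg G * (1 + 2 * orbit_count M') = 4 * k"
    unfolding euler_exponents_def dvd_def by blast
  have F2: "F ^ 2 = sq_arg F * (1 + 2 * orbit_count M) + 4 * h" using h by (simp add: algebra_simps)
  have G2: "G ^ 2 = sq_arg G * (1 + 2 * orbit_count M') + 4 * k" using k by (simp add: algebra_simps)
  have "(F * G) ^ 2 - sq_arg (F * G) * (1 + 2 * (orbit_count M + orbit_count M'))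
      = 4 * (sq_arg F * sq_arg G * orbit_count M * orbit_count M' + h * G ^ 2 + sq_arg F * (1 + 2 * orbit_count M) * k)"
    by (simp only: power_mult_distrib F2 G2 sq_arg_mult) (simp add: algebra_simps)
  then have "4 dvd (F * G) ^ 2 - sq_arg (F * G) * (1 + 2 * (orbit_count M + orbit_count M'))"
    by (metis dvd_triv_left)
  with assms show ?thesis
    by (simp add: euler_exponents_def orbit_count_add ghost_add fps_XD_mult algebra_simps)
qed

lemma euler_exponents_power:
  "euler_exponents F M \<Longrightarrow> euler_exponents (F ^ k) (\<lambda>i. int k * M i)"
proof (induction k)
  case 0
  then show ?case using euler_exponents_one by simp
next
  case (Suc k)
  then show ?case using euler_exponents_mult[of F M "F ^ k" "\<lambda>i. int k * M i"]
    by (simp add: algebra_simps)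
qed

text \<open>
  A negative exponent for a series is a positive one for its inverse.
\<close>

lemma euler_exponents_inverse:
  assumes "euler_exponents F M" and FG: "F * G = 1"
  shows "euler_exponents G (\<lambda>i. - M i)"
proof -
  from assms obtain h where
    h: "F ^ 2 - sq_arg F * (1 + 2 * orbit_count M) = 4 * h" and XF: "fps_XD F = F * ghost M"
    unfolding euler_exponents_def dvd_def by blast
  have "fps_XD (F * G) = 0" by (simp add: FG fps_XD_def)
  then have "F * (fps_XD G + G * ghost M) = 0"
    by (simp add: fps_XD_mult XF algebra_simps)
  then have XG: "fps_XD G = G * (- ghost M)"
    using FG by (auto simp: add_eq_0_iff)
  have s: "sq_arg F * sq_arg G = 1"
    using sq_arg_mult[of F G] by (simp add: FG sq_arg_1)
  have g: "F ^ 2 * G ^ 2 = 1"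
    using FG by (metis power_mult_distrib power_one)
  have F2: "F ^ 2 = sq_arg F * (1 + 2 * orbit_count M) + 4 * h" using h by (simp add: algebra_simps)
  have "G ^ 2 - sq_arg G * (1 + 2 * (- orbit_count M))
      = G ^ 2 * (sq_arg F * sq_arg G) - sq_arg G * (F ^ 2 * G ^ 2) * (1 - 2 * orbit_count M)"
    by (simp add: s g)
  also have "\<dots> = 4 * (G ^ 2 * sq_arg G * (sq_arg F * orbit_count M ^ 2 - h * (1 - 2 * orbit_count M)))"
    unfolding F2 by (simp add: algebra_simps power2_eq_square)
  finally have "4 dvd G ^ 2 - sq_arg G * (1 + 2 * (- orbit_count M))"
    by (metis dvd_triv_left)
  with XG show ?thesis
    by (simp add: euler_exponents_def orbit_count_minus ghost_minus)
qed

definition geom :: "nat \<Rightarrow> int fps" where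
  "geom i = Abs_fps (\<lambda>n. of_bool (i dvd n))"

lemma geom_inverse: "i > 0 \<Longrightarrow> (1 - fps_X ^ i) * geom i = 1"
proof (rule fps_ext)
  fix n assume "i > 0"
  have "((1 - fps_X ^ i) * geom i) $ n = geom i $ n - (if n < i then 0 else geom i $ (n - i))"
    by (simp add: left_diff_distrib fps_X_power_mult_nth)
  also have "\<dots> = (1 :: int fps) $ n"
    using \<open>i > 0\<close> by (auto simp: geom_def dvd_minus_self not_less)
  finally show "((1 - fps_X ^ i) * geom i) $ n = 1 $ n" .
qed

lemma sum_dvd_delta:
  "(n::nat) > 0 \<Longrightarrow> (\<Sum>j | j dvd n. of_bool (j = i) * c j) = (of_bool (i dvd n) * c i :: int)"
proof -
  assume n: "n > 0"
  have "(\<Sum>j | j dvd n. of_bool (j = i) * c j) = (\<Sum>j\<in>(if i dvd n then {i} else {}). c j)"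
    using n by (intro sum.mono_neutral_cong_right) (auto split: if_splits intro: finite_divisors_nat)
  then show ?thesis by simp
qed

text \<open>
  The congruence comes from $(1 - t^i)^2 = (1 - t^{2i})(1 - t^i)/(1 + t^i)$ and
  $(1 - t^i)/(1 + t^i) \equiv (1 + t^i)/(1 - t^i) \equiv 1 - 2 \sum_{j \ge 1} t^{ij}$ modulo 4.
\<close>

lemma euler_exponents_basic:
  assumes "i > 0"
  shows "euler_exponents (1 - fps_X ^ i) (\<lambda>j. - of_bool (j = i))"
proof -
  have ghost: "ghost (\<lambda>j. of_bool (j = i)) = of_nat i * (geom i - 1)"
  proof (rule fps_ext)
    fix n show "ghost (\<lambda>j. of_bool (j = i)) $ n = (of_nat i * (geom i - 1)) $ n"
      using sum_dvd_delta[of n i int]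
      by (auto simp: ghost_def geom_def fps_mult_of_nat_nth mult.commute)
  qed
  have orbit_count: "orbit_count (\<lambda>j. of_bool (j = i)) = geom i - 1"
  proof (rule fps_ext)
    fix n show "orbit_count (\<lambda>j. of_bool (j = i)) $ n = (geom i - 1) $ n"
      using sum_dvd_delta[of n i "\<lambda>_. 1"]
      by (auto simp: orbit_count_def geom_def)
  qed
  have g: "(1 - fps_X ^ i) * (geom i - 1) = fps_X ^ i"
    using geom_inverse[OF assms] by (simp add: algebra_simps)
  have "fps_XD (1 - fps_X ^ i :: int fps) = - of_nat i * fps_X ^ i"
    using assms by (auto simp: fps_eq_iff fps_mult_of_nat_nth simp flip: fps_of_nat)
  also have "\<dots> = (1 - fps_X ^ i) * (- (of_nat i * (geom i - 1)))"
    by (metis g mult.assoc mult.commute mult_minus_left)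
  finally have XD: "fps_XD (1 - fps_X ^ i :: int fps) = (1 - fps_X ^ i) * (- (of_nat i * (geom i - 1)))" .
  have sq: "sq_arg (1 - fps_X ^ i) = (1 - fps_X ^ i) * (1 + fps_X ^ i)"
  proof -
    have "fps_X ^ i oo fps_X ^ 2 = (fps_X ^ i * fps_X ^ i :: int fps)"
      by (simp add: fps_compose_power[symmetric] power2_eq_square power_mult_distrib)
    then show ?thesis by (simp add: sq_arg_def fps_compose_sub_distrib algebra_simps)
  qed
  have "(1 - fps_X ^ i) ^ 2 - sq_arg (1 - fps_X ^ i) * (1 + 2 * - (geom i - 1))
     = (1 - fps_X ^ i) ^ 2 - (1 - fps_X ^ i) * (1 + fps_X ^ i)
        + 2 * (1 + fps_X ^ i) * ((1 - fps_X ^ i) * (geom i - 1))"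
    unfolding sq by (simp add: algebra_simps)
  also have "\<dots> = 4 * (fps_X ^ i * fps_X ^ i)"
    unfolding g by (simp add: algebra_simps power2_eq_square)
  finally have "4 dvd (1 - fps_X ^ i) ^ 2 - sq_arg (1 - fps_X ^ i) * (1 + 2 * - (geom i - 1))"
    by (metis dvd_triv_left)
  with XD show ?thesis
    unfolding euler_exponents_def ghost_minus orbit_count_minus ghost orbit_count by simp
qed

lemma euler_exponents_single:
  assumes "i > 0"
  shows "\<exists>E. E $ 0 = 1 \<and> euler_exponents E (\<lambda>j. c * of_bool (j = i))"
proof (cases "c \<ge> 0")
  case True
  have "euler_exponents (geom i) (\<lambda>j. of_bool (j = i))"
    using euler_exponents_inverse[OF euler_exponents_basic geom_inverse, OF assms assms] by simp
  from euler_exponents_power[OF this, of "nat c"] True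
  have "euler_exponents (geom i ^ nat c) (\<lambda>j. c * of_bool (j = i))" by simp
  moreover have "(geom i ^ nat c) $ 0 = 1" by (simp add: fps_power_zeroth geom_def)
  ultimately show ?thesis by blast
next
  case False
  with euler_exponents_power[OF euler_exponents_basic[OF assms], of "nat (- c)"]
  have "euler_exponents ((1 - fps_X ^ i) ^ nat (- c)) (\<lambda>j. c * of_bool (j = i))" by simp
  moreover have "((1 - fps_X ^ i) ^ nat (- c)) $ 0 = (1 :: int)"
    using assms by (simp add: fps_power_zeroth zero_power)
  ultimately show ?thesis by blast
qed

lemma euler_exponents_single_coeffs:
  assumes "euler_exponents E (\<lambda>j. c * of_bool (j = i))" "E $ 0 = 1" "i > 0"
  shows "E $ i = c" and "0 < k \<Longrightarrow> k < i \<Longrightarrow> E $ k = 0"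
proof -
  let ?M = "\<lambda>j. c * of_bool (j = i)"
  have ghost: "ghost ?M $ k = 0" if "k < i" for k
    using that by (auto simp: ghost_def dvd_imp_le intro!: sum.neutral dest: dvd_imp_le)
  have ghost_i: "ghost ?M $ i = int i * c"
    using assms(3) sum_dvd_delta[of i i "\<lambda>j. int j * c"] by (simp add: ghost_def ac_simps)
  have XD: "int k * E $ k = (\<Sum>j=0..k. E $ j * ghost ?M $ (k - j))" for k
    using assms(1) by (metis euler_exponents_def fps_XD_nth fps_mult_nth)
  have "int i * E $ i = (\<Sum>j\<in>{0}. E $ j * ghost ?M $ (i - j))"
    unfolding XD using assms(3) by (intro sum.mono_neutral_right) (auto intro!: ghost)
  then show "E $ i = c" using assms(2,3) ghost_i by simp
  assume "0 < k" "k < i"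
  then have "int k * E $ k = 0"
    unfolding XD by (intro sum.neutral) (auto intro!: ghost)
  with \<open>0 < k\<close> show "E $ k = 0" by simp
qed

text \<open>
  Correcting one coefficient after the other: a factor with exponent $c$ at $n + 1$ changes the
  coefficient of $t^{n+1}$ by $c$ and leaves the lower ones alone.
\<close>

lemma euler_product_prefix:
  assumes "F $ 0 = (1 :: int)"
  shows "\<exists>M P. euler_exponents P M \<and> (\<forall>k\<le>n. P $ k = F $ k)"
proof (induction n)
  case 0
  show ?case using euler_exponents_one assms by (intro exI[of _ "\<lambda>_. 0"] exI[of _ 1]) simp
next
  case (Suc n)
  then obtain M P where P: "euler_exponents P M" "\<And>k. k \<le> n \<Longrightarrow> P $ k = F $ k" by blast
  \<comment> \<open>The correction that is missing in degree \<open>n + 1\<close>.\<close>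
  define c where "c = F $ Suc n - P $ Suc n"
  obtain E where E: "E $ 0 = 1" "euler_exponents E (\<lambda>j. c * of_bool (j = Suc n))"
    using euler_exponents_single[of "Suc n" c] by auto
  note E' = euler_exponents_single_coeffs[OF E(2,1)]
  have "(P * E) $ k = F $ k" if "k \<le> Suc n" for k
  proof -
    have "(P * E) $ k = (\<Sum>j=0..k. E $ j * P $ (k - j))"
      by (simp add: fps_mult_nth mult.commute[of P])
    also have "\<dots> = (\<Sum>j\<in>{0} \<union> (if k = Suc n then {Suc n} else {}). E $ j * P $ (k - j))"
      using that E'(2) by (intro sum.mono_neutral_right) (auto split: if_splits)
    also have "\<dots> = F $ k"
      using that P(2)[of k] P(2)[of 0] E(1) E'(1) assms by (auto simp: c_def)
    finally show ?thesis .
  qed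
  with euler_exponents_mult[OF P(1) E(2)] show ?case by blast
qed

lemma sq_arg_nth: "sq_arg F $ n = (if even n then F $ (n div 2) else 0)"
proof -
  have "sq_arg F $ n = (\<Sum>i=0..n. if 2 * i = n then F $ i else 0)"
    by (auto simp: sq_arg_def fps_compose_nth fps_X_power_nth if_distrib intro!: sum.cong
       simp flip: power_mult)
  also have "\<dots> = (\<Sum>i\<in>(if even n then {n div 2} else {}). F $ i)"
    by (rule sum.mono_neutral_cong_right) (auto split: if_splits)
  finally show ?thesis by simp
qed

lemma fps_mult_nth_cong:
  assumes "\<And>k. k \<le> n \<Longrightarrow> F $ k = F' $ k" "\<And>k. k \<le> n \<Longrightarrow> G $ k = G' $ k"
  shows "(F * G) $ n = (F' * G') $ n"
  using assms by (simp add: fps_mult_nth)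

text \<open>
  Both properties of \<open>euler_exponents\<close> pass from a finite product to every power series with the
  same first coefficients. A bound \<open>n\<close> is enough for the application, and it avoids the
  convergence of the infinite product.
\<close>

lemma euler_exponents_upto:
  fixes F R :: "int fps"
  assumes "F $ 0 = 1" "fps_XD F = F * R" "R $ 0 = 0"
  shows "\<exists>M. (\<forall>k\<le>n. ghost M $ k = R $ k \<and> 4 dvd (F ^ 2 - sq_arg F * (1 + 2 * orbit_count M)) $ k)"
proof -
  obtain M P where P: "euler_exponents P M" "\<And>k. k \<le> n \<Longrightarrow> P $ k = F $ k"
    using euler_product_prefix[OF assms(1)] by blast
  have "ghost M $ k = R $ k" if "k \<le> n" for k
    using that
  proof (induction k rule: less_induct)
    case (less k)
    have "(P * ghost M) $ k = (F * R) $ k"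
      using P less.prems by (metis euler_exponents_def fps_XD_nth assms(2))
    then have "(\<Sum>j\<in>{0..k}. F $ j * ghost M $ (k - j)) = (\<Sum>j\<in>{0..k}. F $ j * R $ (k - j))"
      using P(2) less.prems by (simp add: fps_mult_nth)
    moreover have "(\<Sum>j\<in>{1..k}. F $ j * ghost M $ (k - j)) = (\<Sum>j\<in>{1..k}. F $ j * R $ (k - j))"
      using less by (intro sum.cong) auto
    ultimately show ?case using assms(1) by (simp add: sum.atLeast_Suc_atMost[of 0 k])
  qed
  moreover have "4 dvd (F ^ 2 - sq_arg F * (1 + 2 * orbit_count M)) $ k" if "k \<le> n" for k
  proof -
    obtain h where "P ^ 2 - sq_arg P * (1 + 2 * orbit_count M) = 4 * h"
      using P(1) unfolding euler_exponents_def dvd_def by blast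
    then have "4 dvd (P ^ 2 - sq_arg P * (1 + 2 * orbit_count M)) $ k"
      by (simp add: numeral_fps_const)
    moreover have "(P ^ 2) $ k = (F ^ 2) $ k"
      unfolding power2_eq_square using P(2) that by (intro fps_mult_nth_cong) auto
    moreover have "(sq_arg P * (1 + 2 * orbit_count M)) $ k = (sq_arg F * (1 + 2 * orbit_count M)) $ k"
      using P(2) that by (intro fps_mult_nth_cong) (auto simp: sq_arg_nth)
    ultimately show ?thesis by simp
  qed
  ultimately show ?thesis by blast
qed

text \<open>
  The power sums $\alpha^n + \beta^n$ of the roots of $x^2 - ax + q$.
\<close>

fun lucas_v :: "int \<Rightarrow> int \<Rightarrow> nat \<Rightarrow> int" where
  "lucas_v a q 0 = 2"
| "lucas_v a q (Suc 0) = a"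
| "lucas_v a q (Suc (Suc n)) = a * lucas_v a q (Suc n) - q * lucas_v a q n"

text \<open>
  Up to even summands, the coefficients of $C(t)/F(t^2)$ for $F = 1 - at + qt^2$ and
  $2 C(t) = F(t)^2 - F(t^2)$. Signs are dropped, because only the parity of these numbers matters.
\<close>

fun lucas_parity :: "int \<Rightarrow> int \<Rightarrow> nat \<Rightarrow> int" where
  "lucas_parity a q 0 = 0"
| "lucas_parity a q (Suc 0) = a"
| "lucas_parity a q (Suc (Suc 0)) = a * (a + 1) div 2 + q"
| "lucas_parity a q (Suc (Suc (Suc 0))) = a * a + a * q"
| "lucas_parity a q (Suc (Suc (Suc (Suc 0)))) = a * (a * (a + 1) div 2 + q) + q * (q - 1) div 2"
| "lucas_parity a q (Suc (Suc (Suc (Suc (Suc n))))) =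
     a * lucas_parity a q (Suc (Suc (Suc n))) + q * lucas_parity a q (Suc n)"

text \<open>
  The numerator of $Z$ and the factors of its denominator have the form $1 - at + qt^2$, with $q = 0$ for the
  linear factors. Comparing coefficients in $F(t)^2 - F(t^2) \equiv 2 F(t^2) \sum_n B(n) t^n$
  modulo 4 and dividing by 2 gives the recurrence for the parity of $B(n)$.
\<close>

lemma lucas_exponents:
  "\<exists>M. (\<forall>k. 1 \<le> k \<and> k \<le> n \<longrightarrow> (\<Sum>i | i dvd k. int i * M i) = - lucas_v a q k
      \<and> (even (\<Sum>i | i dvd k. M i) \<longleftrightarrow> even (lucas_parity a q k)))"
proof -
  define F where "F = 1 - fps_const a * fps_X + fps_const q * fps_X ^ 2"
  define R where "R = Abs_fps (\<lambda>k. if k = 0 then 0 else - lucas_v a q k)"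
  have "fps_XD F = F * R"
  proof (rule fps_ext)
    fix k
    have "(F * R) $ k = R $ k - (if k = 0 then 0 else a * R $ (k - 1)) + (if k < 2 then 0 else q * R $ (k - 2))"
      by (simp add: F_def left_diff_distrib distrib_right mult.assoc fps_X_power_mult_nth)
    moreover have "k = 0 \<or> k = 1 \<or> k = 2 \<or> (\<exists>j. k = j + 3)" by presburger
    ultimately show "fps_XD F $ k = (F * R) $ k"
      by (elim disjE exE) (auto simp: F_def R_def fps_X_power_nth numeral_2_eq_2 numeral_3_eq_3 right_diff_distrib)
  qed
  then obtain M where M: "\<And>k. k \<le> n \<Longrightarrow> ghost M $ k = R $ k"
    "\<And>k. k \<le> n \<Longrightarrow> 4 dvd (F ^ 2 - sq_arg F * (1 + 2 * orbit_count M)) $ k"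
    using euler_exponents_upto[of F R n] by (auto simp: F_def R_def)
  define b where "b = fps_nth (orbit_count M)"
  have b0: "b 0 = 0" by (simp add: b_def orbit_count_def)
  have sqF: "sq_arg F = 1 - fps_const a * fps_X ^ 2 + fps_const q * fps_X ^ 4"
    by (simp add: F_def sq_arg_def fps_compose_sub_distrib fps_compose_add_distrib
       fps_compose_mult_distrib fps_compose_power[symmetric] power_mult[symmetric])
  have F2: "F ^ 2 = 1 - fps_const (2 * a) * fps_X + fps_const (a ^ 2 + 2 * q) * fps_X ^ 2
      - fps_const (2 * a * q) * fps_X ^ 3 + fps_const (q ^ 2) * fps_X ^ 4"
  proof -
    have 1: "fps_const (2 * a) = 2 * fps_const a" "fps_const (q ^ 2) = fps_const q ^ 2"
      "fps_const (a ^ 2 + 2 * q) = fps_const a ^ 2 + 2 * fps_const q"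
      "fps_const (2 * a * q) = 2 * fps_const a * fps_const q"
      by (simp_all add: numeral_fps_const fps_const_power)
    have "(1 - A * u + B * u ^ 2) ^ 2 = 1 - 2 * A * u + (A ^ 2 + 2 * B) * u ^ 2
        - 2 * A * B * u ^ 3 + B ^ 2 * u ^ 4" for A B u :: "int fps"
      by (simp add: algebra_simps power2_eq_square power3_eq_cube power4_eq_xxxx)
    then show ?thesis unfolding 1 F_def by blast
  qed
  have coeff: "(F ^ 2 - sq_arg F * (1 + 2 * orbit_count M)) $ k =
     (if k = 1 then - 2 * a else if k = 2 then a ^ 2 + 2 * q + a else if k = 3 then - 2 * a * q
      else if k = 4 then q ^ 2 - q else 0)
     - 2 * (b k - (if k < 2 then 0 else a * b (k - 2)) + (if k < 4 then 0 else q * b (k - 4)))" for k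
  proof -
    have "F ^ 2 - sq_arg F * (1 + 2 * orbit_count M) = (F ^ 2 - sq_arg F) - fps_const 2 * (sq_arg F * orbit_count M)"
      by (simp add: algebra_simps flip: numeral_fps_const)
    then have "(F ^ 2 - sq_arg F * (1 + 2 * orbit_count M)) $ k = (F ^ 2 - sq_arg F) $ k - 2 * (sq_arg F * orbit_count M) $ k"
      by (simp only: fps_sub_nth fps_mult_left_const_nth)
    moreover have "(F ^ 2 - sq_arg F) $ k = (if k = 1 then - 2 * a else if k = 2 then a ^ 2 + 2 * q + a
        else if k = 3 then - 2 * a * q else if k = 4 then q ^ 2 - q else 0)"
      unfolding F2 sqF by (auto simp: fps_X_power_nth)
    moreover have "(sq_arg F * orbit_count M) $ k =
        b k - (if k < 2 then 0 else a * b (k - 2)) + (if k < 4 then 0 else q * b (k - 4))"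
      unfolding sqF by (simp add: b_def left_diff_distrib distrib_right mult.assoc fps_X_power_mult_nth)
    ultimately show ?thesis by (simp only:)
  qed
  have "even (b k) \<longleftrightarrow> even (lucas_parity a q k)" if "k \<le> n" for k
    using that
  proof (induction k rule: less_induct)
    case (less k)
    from M(2)[OF less.prems] obtain c where "(F ^ 2 - sq_arg F * (1 + 2 * orbit_count M)) $ k = 4 * c" ..
    note c = this[unfolded coeff]
    have "k = 0 \<or> k = 1 \<or> k = 2 \<or> k = 3 \<or> k = 4 \<or> (\<exists>j. k = j + 5)" by presburger
    then consider "k = 0" | "k = 1" | "k = 2" | "k = 3" | "k = 4" | j where "k = j + 5" by blast
    then show ?case
    proof cases
      case 1 then show ?thesis by (simp add: b0)
    next
      case 2
      with c have "2 * (- a - b k) = 2 * (2 * c)" by simp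
      then have "b k = - a - 2 * c" by simp
      with 2 show ?thesis by simp
    next
      case 3
      have a: "a * (a + 1) = 2 * (a * (a + 1) div 2)" by simp
      have "2 * (a * (a + 1) div 2 + q - b k) = 2 * (2 * c)"
        using c 3 a by (simp add: b0 power2_eq_square algebra_simps)
      then have "b k = a * (a + 1) div 2 + q - 2 * c" by simp
      with 3 show ?thesis by (simp add: numeral_2_eq_2)
    next
      case 4
      have "2 * (- (a * q) - b k + a * b 1) = 2 * (2 * c)"
        using c 4 by (simp add: algebra_simps)
      then have "b k = - (a * q) + a * b 1 - 2 * c" by simp
      with 4 less.IH[of 1] less.prems show ?thesis by (auto simp: numeral_3_eq_3)
    next
      case 5
      have q: "q * (q - 1) = 2 * (q * (q - 1) div 2)" by simp
      have "2 * (q * (q - 1) div 2 - b k + a * b 2) = 2 * (2 * c)"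
        using c 5 q by (simp add: b0 power2_eq_square algebra_simps)
      then have "b k = q * (q - 1) div 2 + a * b 2 - 2 * c" by simp
      with 5 less.IH[of 2] less.prems show ?thesis by (auto simp: eval_nat_numeral)
    next
      case 6
      have "2 * (- b k + a * b (j + 3) - q * b (j + 1)) = 2 * (2 * c)"
        using c 6 by (simp add: algebra_simps)
      then have "b k = a * b (j + 3) - q * b (j + 1) - 2 * c" by simp
      with 6 less.IH[of "j + 3"] less.IH[of "j + 1"] less.prems show ?thesis
        by (auto simp: eval_nat_numeral)
    qed
  qed
  then have "even (\<Sum>i | i dvd k. M i) \<longleftrightarrow> even (lucas_parity a q k)" if "1 \<le> k" "k \<le> n" for k
    using that by (force simp: b_def orbit_count_def)
  moreover have "(\<Sum>i | i dvd k. int i * M i) = - lucas_v a q k" if "1 \<le> k" "k \<le> n" for k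
    using that M(1)[of k] by (simp add: ghost_def R_def)
  ultimately show ?thesis by blast
qed

section \<open>Moebius inversion and the \<open>\<epsilon>\<close>-component\<close>

text \<open>
  For a prime $p$ dividing $n$, the squarefree divisors prime to $p$ are matched with those
  divisible by $p$ through $d \mapsto pd$, and this changes the sign of $\mu$.
\<close>

lemma sum_moebius:
  assumes "n > 0"
  shows "(\<Sum>d | d dvd n. moebius_mu d) = of_bool (n = 1)"
proof (cases "n = 1")
  case True
  then show ?thesis by (simp add: moebius_mu_def)
next
  case False
  then obtain p where p: "prime p" "p dvd n" by (metis prime_factor_nat)
  define A where "A = {d. d dvd n \<and> squarefree d \<and> \<not> p dvd d}"
  have fin: "finite {d. d dvd n}" using assms by simp
  have finA: "finite A" using fin by (rule rev_finite_subset) (auto simp: A_def)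
  have sf: "squarefree (p * d)" if "d \<in> A" for d
    using that p by (intro squarefree_mult_coprime) (auto simp: A_def squarefree_prime prime_imp_coprime)
  have inj: "inj_on ((*) p) A" using p by (auto simp: inj_on_def)
  have "{d. d dvd n \<and> squarefree d \<and> p dvd d} = (*) p ` A"
  proof (intro equalityI subsetI)
    fix d assume "d \<in> {d. d dvd n \<and> squarefree d \<and> p dvd d}"
    then obtain c where c: "d = p * c" "d dvd n" "squarefree d" by (auto elim: dvdE)
    have "\<not> p dvd c"
    proof
      assume "p dvd c"
      then have "p ^ 2 dvd d" by (simp add: c power2_eq_square)
      with c(3) p(1) show False by (auto simp: squarefree_def)
    qed
    then show "d \<in> (*) p ` A"
      using c squarefree_multD(2)[of p c] by (auto simp: A_def intro!: imageI dest: dvd_mult_right)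
  next
    fix d assume "d \<in> (*) p ` A"
    then show "d \<in> {d. d dvd n \<and> squarefree d \<and> p dvd d}"
      using sf p by (auto simp: A_def intro!: divides_mult prime_imp_coprime)
  qed
  moreover have "moebius_mu (p * d) = - moebius_mu d" if "d \<in> A" for d
  proof -
    have "d > 0" using that assms by (auto simp: A_def intro!: Nat.gr0I)
    then have "prime_factors (p * d) = insert p (prime_factors d)"
      using p by (simp add: prime_factorization_mult prime_factorization_prime)
    moreover have "p \<notin> prime_factors d" using that by (auto simp: A_def)
    ultimately show ?thesis
      using sf[OF that] that by (simp add: moebius_mu_def A_def)
  qed
  ultimately have B: "(\<Sum>d | d dvd n \<and> squarefree d \<and> p dvd d. moebius_mu d) = - (\<Sum>d\<in>A. moebius_mu d)"
    using inj by (simp add: sum.reindex sum_negf)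
  have "(\<Sum>d | d dvd n. moebius_mu d) = (\<Sum>d\<in>A \<union> {d. d dvd n \<and> squarefree d \<and> p dvd d}. moebius_mu d)"
    using fin by (intro sum.mono_neutral_right) (auto simp: A_def moebius_mu_def)
  also have "\<dots> = (\<Sum>d\<in>A. moebius_mu d) + (\<Sum>d | d dvd n \<and> squarefree d \<and> p dvd d. moebius_mu d)"
    using fin finA by (intro sum.union_disjoint) (auto simp: A_def)
  finally show ?thesis using B False by simp
qed

lemma moebius_inversion:
  fixes N g :: "nat \<Rightarrow> int"
  assumes "n > 0" and N: "\<And>k. k dvd n \<Longrightarrow> (\<Sum>i | i dvd k. g i) = N k"
  shows "(\<Sum>d | d dvd n. moebius_mu d * N (n div d)) = g n"
proof -
  let ?D = "{d. d dvd n}"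
  have fin: "finite ?D" using assms by simp
  have D: "{i. i dvd n div d} = {i \<in> ?D. d * i dvd n}" if "d dvd n" for d
  proof -
    from that obtain e where e: "n = d * e" ..
    with assms(1) show ?thesis by auto
  qed
  have "(\<Sum>d\<in>?D. moebius_mu d * N (n div d)) = (\<Sum>d\<in>?D. \<Sum>i | i \<in> ?D \<and> d * i dvd n. moebius_mu d * g i)"
  proof (intro sum.cong refl)
    fix d assume "d \<in> ?D"
    then have "n div d dvd n" by (auto simp: assms(1))
    with \<open>d \<in> ?D\<close> have "N (n div d) = (\<Sum>i | i \<in> ?D \<and> d * i dvd n. g i)"
      using N[of "n div d"] D[of d] by simp
    then show "moebius_mu d * N (n div d) = (\<Sum>i | i \<in> ?D \<and> d * i dvd n. moebius_mu d * g i)"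
      by (simp add: sum_distrib_left)
  qed
  also have "\<dots> = (\<Sum>i\<in>?D. \<Sum>d | d \<in> ?D \<and> d * i dvd n. moebius_mu d * g i)"
    using fin by (intro sum.swap_restrict) auto
  also have "\<dots> = (\<Sum>i\<in>?D. of_bool (n = i) * g i)"
  proof (intro sum.cong refl)
    fix i assume "i \<in> ?D"
    then obtain e where e: "n = i * e" by auto
    have "(\<Sum>d | d \<in> ?D \<and> d * i dvd n. moebius_mu d) = (\<Sum>d | d dvd n div i. moebius_mu d)"
      using D[of i] \<open>i \<in> ?D\<close> by (simp add: mult.commute)
    also have "\<dots> = of_bool (n = i)"
      using sum_moebius[of "n div i"] e assms(1) by auto
    finally show "(\<Sum>d | d \<in> ?D \<and> d * i dvd n. moebius_mu d * g i) = of_bool (n = i) * g i"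
      by (simp add: sum_distrib_right[symmetric])
  qed
  also have "\<dots> = (\<Sum>i\<in>{n}. of_bool (n = i) * g i)"
    using fin by (intro sum.mono_neutral_right) auto
  finally show ?thesis by simp
qed

text \<open>
  The division by $n$ in the definition of the number of closed points is exact as soon as integral
  exponents are known to exist.
\<close>

lemma closed_points_eq:
  assumes "n > 0" and "\<And>k. k dvd n \<Longrightarrow> (\<Sum>i | i dvd k. int i * M i) = int (N k)"
  shows "closed_points N n = M n"
  using moebius_inversion[of n "\<lambda>i. int i * M i" "\<lambda>k. int (N k)"] assms
  by (simp add: closed_points_def)

lemma of_int_mult_gw_eps: "of_int n * gw_eps = (if odd n then gw_eps else 0)"
proof -
  have "of_int n * gw_eps = of_int (n div 2) * (gw_eps + gw_eps) + of_int (n mod 2) * gw_eps"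
    by (metis (no_types, opaque_lifting) distrib_left distrib_right mult_2_right
        mult_div_mod_eq mult.commute of_int_add)
  then show ?thesis by (simp add: gw_two_eps odd_iff_mod_2_eq_one even_iff_mod_2_eq_zero)
qed

text \<open>
  For even $i$ one has $(i - 1) + \langle u\rangle = i + \varepsilon$, and $\varepsilon$ is killed
  by 2.
\<close>

lemma gw_eps_component_dlog_zeta:
  assumes "m \<ge> 1"
  shows "gw_eps_component (fps_nth (dlog_zeta_A1 N) (m - 1)) =
    of_bool (odd (\<Sum>i | i dvd m \<and> even i. closed_points N i))"
proof -
  let ?c = "closed_points N"
  define s where "s = (\<Sum>i | i dvd m \<and> even i. ?c i)"
  define t where "t = (\<Sum>i | i dvd m \<and> even i. ?c i * int i) + (\<Sum>i | i dvd m \<and> odd i. ?c i * int i)"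
  have unit: "of_nat (i - 1) + gw_u = of_nat i + gw_eps" if "i dvd m" for i
  proof -
    have "i \<ge> 1" using that assms by (auto intro!: Suc_leI Nat.gr0I)
    then show ?thesis by (simp add: gw_eps_def of_nat_diff)
  qed
  have e: "(\<Sum>i | i dvd m \<and> even i. of_int (?c i) * (of_nat (i - 1) + gw_u)) =
      (\<Sum>i | i dvd m \<and> even i. of_int (?c i) * (of_nat i + gw_eps))"
    using unit by (intro sum.cong refl) simp
  have "fps_nth (dlog_zeta_A1 N) (m - 1) =
      (\<Sum>i | i dvd m \<and> even i. of_int (?c i) * (of_nat i + gw_eps)) +
      (\<Sum>i | i dvd m \<and> odd i. of_int (?c i) * of_nat i)"
    using assms e by (simp add: dlog_zeta_A1_def Let_def)
  also have "\<dots> = of_int t + of_int s * gw_eps"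
    by (simp add: t_def s_def distrib_left sum.distrib sum_distrib_right)
  also have "\<dots> = of_int t + (if (of_bool (odd s) :: bit) = 1 then gw_eps else 0)"
    by (simp add: of_int_mult_gw_eps)
  finally show ?thesis by (simp only: gw_eps_component_eq s_def)
qed

section \<open>Polynomials over finite fields and the quadratic character\<close>

lemma proots_prod_linear:
  "proots (\<Prod>x\<in>#A. [:- x, 1:]) = (A :: 'k::idom multiset)"
proof (induction A)
  case (add x A)
  have "(\<Prod>x\<in>#A. [:- x, 1:]) \<noteq> 0" by (auto simp: prod_mset_zero_iff)
  with add show ?case by (simp add: proots_mult del: mult_pCons_left)
qed simp

lemma proots_factorization:
  fixes p :: "'k::alg_closed_field poly"
  assumes "p \<noteq> 0"
  shows "p = Polynomial.smult (lead_coeff p) (\<Prod>x\<in>#proots p. [:- x, 1:])"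
    and "size (proots p) = Polynomial.degree p"
proof -
  obtain A where A: "size A = Polynomial.degree p"
    "p = Polynomial.smult (lead_coeff p) (\<Prod>x\<in>#A. [:- x, 1:])"
    using alg_closed_imp_factorization[OF assms] by blast
  have "proots p = A"
    using assms by (subst A(2)) (simp add: proots_prod_linear)
  with A show "p = Polynomial.smult (lead_coeff p) (\<Prod>x\<in>#proots p. [:- x, 1:])"
    "size (proots p) = Polynomial.degree p" by simp_all
qed

lemma sum_order_roots:
  fixes p :: "'k::alg_closed_field poly"
  assumes "p \<noteq> 0"
  shows "(\<Sum>x | poly p x = 0. Polynomial.order x p) = Polynomial.degree p"
  using proots_factorization(2)[OF assms] assms
  by (simp add: size_multiset_overloaded_eq)

lemma card_roots_separable:
  fixes p :: "'k::alg_closed_field poly"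
  assumes "\<And>x. poly p x = 0 \<Longrightarrow> poly (pderiv p) x \<noteq> 0"
  shows "card {x. poly p x = 0} = Polynomial.degree p"
proof -
  have p: "p \<noteq> 0" using assms by auto
  have "Polynomial.order x p = 1" if "poly p x = 0" for x
  proof -
    have "\<not> 2 \<le> Polynomial.order x p"
    proof
      assume "2 \<le> Polynomial.order x p"
      then have "[:- x, 1:] ^ 2 dvd p" by (simp add: order_divides)
      then obtain h where "p = [:- x, 1:] ^ 2 * h" ..
      then have "poly (pderiv p) x = 0"
        by (simp add: pderiv_mult power2_eq_square del: mult_pCons_left mult_pCons_right)
      with assms that show False by blast
    qed
    moreover have "Polynomial.order x p \<noteq> 0" using that p by (simp add: order_root)
    ultimately show ?thesis by linarith
  qed
  then have "card {x. poly p x = 0} = (\<Sum>x | poly p x = 0. Polynomial.order x p)" by simp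
  with sum_order_roots[OF p] show ?thesis by simp
qed

text \<open>
  Applied to $z^{(q-1)/2} \in \{0, 1, -1\}$, this is the quadratic character of $z$ with integer
  values.
\<close>

definition unit_sign :: "'k::field \<Rightarrow> int" where
  "unit_sign z = (if z = 0 then 0 else if z = 1 then 1 else - 1)"

lemma unit_sign_mult:
  assumes "(2::'k::field) \<noteq> 0" "x \<in> {0, 1, - 1 :: 'k}" "y \<in> {0, 1, - 1}"
  shows "unit_sign (x * y) = unit_sign x * unit_sign y"
proof -
  have "(- 1 :: 'k) \<noteq> 1" using assms(1) by (metis add.right_inverse one_add_one)
  with assms(2,3) show ?thesis by (auto simp: unit_sign_def)
qed

text \<open>
  A separable monic cubic over $\mathbb{F}_q$, viewed inside an algebraically closed field of the
  same odd characteristic. All fields $\mathbb{F}_{q^n}$ are then subsets of one type, and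
  rationality over $\mathbb{F}_q$ is invariance under the $q$-th power map.
\<close>

locale cubic_over_finite =
  fixes q :: nat and f :: "'k::alg_closed_field poly"
  assumes odd_q: "odd q" and q_gt_1: "q > 1"
    and frob_add: "\<And>x y :: 'k. (x + y) ^ q = x ^ q + y ^ q"
    and of_nat_q: "of_nat q = (0 :: 'k)"
    and degree_f: "Polynomial.degree f = 3" and monic_f: "lead_coeff f = 1"
    and rational_f: "map_poly (\<lambda>x. x ^ q) f = f"
    and separable_f: "\<And>x. poly f x = 0 \<Longrightarrow> poly (pderiv f) x \<noteq> 0"
begin

definition Fq :: "nat \<Rightarrow> 'k set" where
  "Fq n = {x. x ^ (q ^ n) = x}"

lemma two_neq_0: "(2 :: 'k) \<noteq> 0"
proof
  assume 2: "(2 :: 'k) = 0"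
  from odd_q obtain k where "q = 2 * k + 1" by (elim oddE)
  with of_nat_q 2 show False by simp
qed

lemma one_neq_minus_1: "(- 1 :: 'k) \<noteq> 1"
  using two_neq_0 by (metis add.right_inverse one_add_one)

lemma q_pow_gt_1: "k > 0 \<Longrightarrow> q ^ k > 1"
  using q_gt_1 by (intro one_less_power) auto

lemma frob_add_pow: "((x::'k) + y) ^ (q ^ n) = x ^ (q ^ n) + y ^ (q ^ n)"
proof (induction n)
  case (Suc n)
  then show ?case by (simp add: power_Suc2 power_mult frob_add del: power_Suc)
qed simp

lemma frob_minus_pow: "(- (x::'k)) ^ (q ^ n) = - (x ^ (q ^ n))"
  using odd_q by (simp add: power_minus_odd)

lemma frob_diff_pow: "((x::'k) - y) ^ (q ^ n) = x ^ (q ^ n) - y ^ (q ^ n)"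
  using frob_add_pow[of x "- y"] by (simp add: frob_minus_pow)

lemma frob_sum: "(\<Sum>i\<in>I. g i :: 'k) ^ q = (\<Sum>i\<in>I. g i ^ q)"
  using q_gt_1 by (induction I rule: infinite_finite_induct) (auto simp: frob_add)

lemma frob_inj_pow: "(x::'k) ^ (q ^ n) = y ^ (q ^ n) \<longleftrightarrow> x = y"
proof
  assume "x ^ (q ^ n) = y ^ (q ^ n)"
  then have "(x - y) ^ (q ^ n) = 0" by (simp add: frob_diff_pow)
  then show "x = y" by simp
qed simp

lemma frob_pow_pow: "((x::'k) ^ (q ^ m)) ^ (q ^ n) = x ^ (q ^ (m + n))"
  by (simp add: power_add power_mult)

lemma Fq_1: "x \<in> Fq 1 \<longleftrightarrow> x ^ q = x"
  by (simp add: Fq_def)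

lemma Fq_closed:
  "0 \<in> Fq n" "1 \<in> Fq n"
  "x \<in> Fq n \<Longrightarrow> y \<in> Fq n \<Longrightarrow> x + y \<in> Fq n"
  "x \<in> Fq n \<Longrightarrow> y \<in> Fq n \<Longrightarrow> x - y \<in> Fq n"
  "x \<in> Fq n \<Longrightarrow> y \<in> Fq n \<Longrightarrow> x * y \<in> Fq n"
  "x \<in> Fq n \<Longrightarrow> y \<in> Fq n \<Longrightarrow> x / y \<in> Fq n"
  "x \<in> Fq n \<Longrightarrow> - x \<in> Fq n"
  "x \<in> Fq n \<Longrightarrow> x ^ k \<in> Fq n"
  using q_gt_1 by (auto simp: Fq_def frob_add_pow frob_diff_pow frob_minus_pow power_mult_distrib
      power_divide power_0_left power_commuting_commutes) (metis power_commutes power_mult mult.commute)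

lemma Fq_1_subset: "x \<in> Fq 1 \<Longrightarrow> x \<in> Fq n"
proof (induction n)
  case (Suc n)
  then show ?case by (simp add: Fq_def power_Suc2 power_mult del: power_Suc)
qed (simp add: Fq_def)

text \<open>
  The derivative of $X^{q^n} - X$ is the constant $-1$, so all its roots are simple.
\<close>

lemma card_Fq: assumes "n > 0" shows "card (Fq n) = q ^ n"
proof -
  let ?p = "Polynomial.monom 1 (q ^ n) - [:0, 1 :: 'k:]"
  have "Polynomial.degree ?p = q ^ n"
    using q_pow_gt_1[OF assms] by (simp add: degree_add_eq_left degree_monom_eq diff_conv_add_uminus del: add_uminus_conv_diff)
  moreover have "poly (pderiv ?p) x \<noteq> 0" for x
    using assms of_nat_q by (simp add: pderiv_diff pderiv_monom pderiv_pCons poly_monom power_0_left)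
  moreover have "Fq n = {x. poly ?p x = 0}" by (simp add: Fq_def poly_monom)
  ultimately show ?thesis using card_roots_separable[of ?p] by simp
qed

lemma finite_Fq: "n > 0 \<Longrightarrow> finite (Fq n)"
  using card_Fq[of n] q_gt_1 by (intro card_ge_0_finite) simp

text \<open>
  A polynomial has coefficients in $\mathbb{F}_q$ if and only if it is fixed by this ring
  endomorphism. Stated in this way, rationality passes to quotients by cancellation.
\<close>

definition frob :: "'k poly \<Rightarrow> 'k poly" where
  "frob h = map_poly (\<lambda>x. x ^ q) h"

lemma coeff_frob: "coeff (frob h) i = coeff h i ^ q"
  using q_gt_1 by (simp add: frob_def coeff_map_poly)

lemma frob_mult: "frob (g * h) = frob g * frob h"
  by (intro poly_eqI) (simp add: coeff_frob coeff_mult frob_sum power_mult_distrib)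

lemma frob_plus: "frob (g + h) = frob g + frob h"
  by (intro poly_eqI) (simp add: coeff_frob frob_add)

lemma frob_diff: "frob (g - h) = frob g - frob h"
  using frob_diff_pow[of _ _ 1] by (intro poly_eqI) (simp add: coeff_frob)

lemma frob_pCons: "frob (pCons a h) = pCons (a ^ q) (frob h)"
  using q_gt_1 by (intro poly_eqI) (simp add: coeff_frob coeff_pCons split: nat.split)

lemma frob_1: "frob 1 = 1"
  using q_gt_1 by (simp add: frob_def)

lemma frob_0: "frob 0 = 0"
  by (simp add: frob_def)

lemma frob_monom: "frob (Polynomial.monom a n) = Polynomial.monom (a ^ q) n"
  using q_gt_1 by (intro poly_eqI) (simp add: coeff_frob)

lemma frob_smult: "frob (Polynomial.smult a h) = Polynomial.smult (a ^ q) (frob h)"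
  by (intro poly_eqI) (simp add: coeff_frob power_mult_distrib)

lemma frob_f: "frob f = f"
  using rational_f by (simp add: frob_def)

lemma frob_prod: "frob (\<Prod>i\<in>I. g i) = (\<Prod>i\<in>I. frob (g i))"
  by (induction I rule: infinite_finite_induct) (auto simp: frob_mult frob_1)

lemma poly_frob: "frob h = h \<Longrightarrow> poly h (x ^ q) = poly h x ^ q"
proof -
  have "poly (frob h) (x ^ q) = poly h x ^ q" for h
    by (induction h) (simp_all add: frob_pCons frob_0 frob_add power_mult_distrib q_gt_1[THEN less_trans[OF zero_less_one]])
  then show "frob h = h \<Longrightarrow> poly h (x ^ q) = poly h x ^ q" by metis
qed

lemma poly_frob_pow: "frob h = h \<Longrightarrow> poly h (x ^ (q ^ n)) = poly h x ^ (q ^ n)"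
proof (induction n)
  case (Suc n)
  then show ?case by (simp add: power_Suc2 power_mult poly_frob del: power_Suc)
qed simp

lemma poly_in_Fq: "frob h = h \<Longrightarrow> x \<in> Fq n \<Longrightarrow> poly h x \<in> Fq n"
  by (simp add: Fq_def flip: poly_frob_pow)

lemma rational_cancel:
  assumes "frob (c * h) = c * h" "frob c = c" "c \<noteq> 0" shows "frob h = h"
  using assms by (simp add: frob_mult)

lemma Fq_1_coeff: "frob h = h \<Longrightarrow> coeff h i \<in> Fq 1"
  by (metis Fq_1 coeff_frob)

definition monics :: "nat \<Rightarrow> 'k poly set" where
  "monics n = {h. Polynomial.degree h = n \<and> lead_coeff h = 1 \<and> frob h = h}"

lemma finite_monics: "finite (monics n)"
proof (rule inj_on_finite)
  let ?c = "\<lambda>h::'k poly. \<lambda>i\<in>{..n}. coeff h i"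
  show "?c ` monics n \<subseteq> PiE {..n} (\<lambda>_. Fq 1)"
    using Fq_1_coeff by (auto simp: monics_def PiE_def)
  show "finite (PiE {..n} (\<lambda>_. Fq 1))"
    by (intro finite_PiE finite_Fq) auto
  show "inj_on ?c (monics n)"
  proof (rule inj_onI, rule poly_eqI)
    fix g h i assume gh: "g \<in> monics n" "h \<in> monics n" "?c g = ?c h"
    show "coeff g i = coeff h i"
    proof (cases "i \<le> n")
      case True
      with fun_cong[OF gh(3), of i] show ?thesis by simp
    next
      case False
      with gh show ?thesis by (simp add: monics_def coeff_eq_0)
    qed
  qed
qed

definition num_sqrts :: "nat \<Rightarrow> 'k \<Rightarrow> nat" where
  "num_sqrts k z = card {y \<in> Fq k. y ^ 2 = z}"

lemma half_double: "k > 0 \<Longrightarrow> 2 * ((q ^ k - 1) div 2) = q ^ k - 1"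
  using odd_q by simp

lemma half_pos: "k > 0 \<Longrightarrow> (q ^ k - 1) div 2 > 0"
  using q_pow_gt_1[of k] half_double[of k] by linarith

lemma in_Fq_nonzero: "y \<noteq> 0 \<Longrightarrow> y \<in> Fq k \<longleftrightarrow> y ^ (q ^ k - 1) = 1"
proof -
  assume y: "y \<noteq> 0"
  have "y ^ (q ^ k) = y * y ^ (q ^ k - 1)"
    using q_gt_1 by (subst power_Suc[symmetric]) simp
  with y show ?thesis by (simp add: Fq_def)
qed

lemma half_power_cases:
  assumes "z \<in> Fq k" "k > 0"
  shows "z ^ ((q ^ k - 1) div 2) \<in> {0, 1, - 1}"
proof (cases "z = 0")
  case True
  then show ?thesis using half_pos[OF assms(2)] by (simp add: power_0_left)
next
  case False
  then have "(z ^ ((q ^ k - 1) div 2)) ^ 2 = 1"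
    using assms half_double[OF assms(2)] by (simp add: in_Fq_nonzero mult.commute flip: power_mult)
  then show ?thesis by (auto simp: power2_eq_1_iff)
qed

text \<open>
  Euler's criterion: a square root $y$ of $z \ne 0$ lies in $\mathbb{F}_{q^k}$ if and only if
  $y^{q^k - 1} = z^{(q^k-1)/2}$ equals 1.
\<close>

lemma num_sqrts_eq_unit_sign:
  assumes "z \<in> Fq k" "k > 0"
  shows "int (num_sqrts k z) = 1 + unit_sign (z ^ ((q ^ k - 1) div 2))"
proof (cases "z = 0")
  case True
  then have "{y \<in> Fq k. y ^ 2 = z} = {0}" using Fq_closed(1) by auto
  then show ?thesis using True half_pos[OF assms(2)] by (simp add: num_sqrts_def unit_sign_def power_0_left)
next
  case False
  obtain y where y: "y ^ 2 = z" using nth_root_exists[of 2 z] by auto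
  with False have y0: "y \<noteq> 0" by auto
  have "y \<noteq> - y"
    using y0 two_neq_0 by (metis add.right_inverse mult_2 mult_eq_0_iff)
  then have card2: "card {y, - y} = 2" by simp
  have "{x. x ^ 2 = z} = {y, - y}" using y by (auto simp: power2_eq_iff)
  moreover have "y \<in> Fq k \<longleftrightarrow> z ^ ((q ^ k - 1) div 2) = 1"
    using y half_double[OF assms(2)] by (metis in_Fq_nonzero[OF y0] power_mult)
  moreover have "- y \<in> Fq k \<longleftrightarrow> y \<in> Fq k" using Fq_closed(7) by fastforce
  ultimately have "{x \<in> Fq k. x ^ 2 = z} = (if z ^ ((q ^ k - 1) div 2) = 1 then {y, - y} else {})"
    by auto
  then show ?thesis using card2 False by (simp add: num_sqrts_def unit_sign_def)
qed


text \<open>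
  The resultant of \<open>f\<close> and \<open>h\<close>. It depends only on the values of \<open>h\<close> at the roots of \<open>f\<close>, which makes
  it multiplicative in \<open>h\<close> and invariant under adding multiples of \<open>f\<close>.
\<close>

definition norm_f :: "'k poly \<Rightarrow> 'k" where
  "norm_f h = (\<Prod>b\<in>#proots f. poly h b)"

text \<open>
  For monic \<open>h\<close> the sign $(-1)^{\deg h}$ turns the resultant into the product of the values of \<open>f\<close>
  at the roots of \<open>h\<close>.
\<close>

definition chi :: "'k poly \<Rightarrow> int" where
  "chi h = unit_sign (((- 1) ^ Polynomial.degree h * norm_f h) ^ ((q - 1) div 2))"

lemma f_neq_0: "f \<noteq> 0" using degree_f by auto

lemma size_roots_f: "size (proots f) = 3"
  using proots_factorization(2)[OF f_neq_0] degree_f by simp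

lemma poly_f: "poly f x = (\<Prod>b\<in>#proots f. x - b)"
  using arg_cong[OF proots_factorization(1)[OF f_neq_0], of "\<lambda>p. poly p x"] monic_f
  by (simp add: poly_prod_mset image_mset.compositionality comp_def)

lemma frob_roots_f: "image_mset (\<lambda>b. b ^ q) (proots f) = proots f"
proof -
  have "frob (\<Prod>b\<in>#A. [:- b, 1:]) = (\<Prod>b\<in>#image_mset (\<lambda>b. b ^ q) A. [:- b, 1:])" for A
    using frob_minus_pow[of _ 1] by (induction A) (simp_all add: frob_1 frob_mult frob_pCons frob_0 del: mult_pCons_left)
  from this[of "proots f"] have "f = (\<Prod>b\<in>#image_mset (\<lambda>b. b ^ q) (proots f). [:- b, 1:])"
    using proots_factorization(1)[OF f_neq_0] monic_f frob_f by simp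
  then show ?thesis by (metis proots_prod_linear)
qed

lemma norm_f_mult: "norm_f (g * h) = norm_f g * norm_f h"
  by (simp add: norm_f_def prod_mset.distrib)

text \<open>
  The $q$-th power map permutes the roots of \<open>f\<close>.
\<close>

lemma norm_f_in_Fq: assumes "frob h = h" shows "norm_f h \<in> Fq 1"
proof -
  have "(\<Prod>b\<in>#A. poly h b) ^ q = (\<Prod>b\<in>#A. poly h b ^ q)" for A
    by (induction A) (simp_all add: power_mult_distrib)
  then have "norm_f h ^ q = (\<Prod>b\<in>#proots f. poly h (b ^ q))"
    by (simp add: norm_f_def poly_frob[OF assms])
  also have "\<dots> = (\<Prod>b\<in>#image_mset (\<lambda>b. b ^ q) (proots f). poly h b)"
    by (simp add: image_mset.compositionality comp_def)
  also have "\<dots> = norm_f h" by (simp add: frob_roots_f norm_f_def)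
  finally show ?thesis by (simp only: Fq_1)
qed

lemma chi_arg_cases: "frob h = h \<Longrightarrow> (((- 1) ^ n * norm_f h) ^ ((q - 1) div 2)) \<in> {0, 1, - 1}"
proof -
  assume "frob h = h"
  then have "(- 1) ^ n * norm_f h \<in> Fq 1"
    by (intro Fq_closed(5) Fq_closed(8) Fq_closed(7) Fq_closed(2) norm_f_in_Fq)
  from half_power_cases[OF this] show ?thesis by (simp only: power_one_right)
qed

lemma chi_mult:
  assumes "frob g = g" "frob h = h" "g \<noteq> 0" "h \<noteq> 0"
  shows "chi (g * h) = chi g * chi h"
proof -
  have "(- 1) ^ Polynomial.degree (g * h) * norm_f (g * h)
      = ((- 1) ^ Polynomial.degree g * norm_f g) * ((- 1) ^ Polynomial.degree h * norm_f h)"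
    using assms by (simp add: degree_mult_eq norm_f_mult power_add)
  then show ?thesis
    unfolding chi_def
    by (simp only: power_mult_distrib[of "_ * norm_f g" "_ * norm_f h"]
        unit_sign_mult[OF two_neq_0 chi_arg_cases[OF assms(1)] chi_arg_cases[OF assms(2)]])
qed

text \<open>
  The characteristic polynomial of $x \in \mathbb{F}_{q^k}$ over $\mathbb{F}_q$, a power of the
  minimal polynomial.
\<close>

definition orbit_poly :: "nat \<Rightarrow> 'k \<Rightarrow> 'k poly" where
  "orbit_poly k x = (\<Prod>i<k. [:- (x ^ (q ^ i)), 1:])"

lemma orbit_poly_neq_0: "orbit_poly k x \<noteq> 0" by (simp add: orbit_poly_def)

lemma degree_orbit_poly: "Polynomial.degree (orbit_poly k x) = k"
  by (simp add: orbit_poly_def degree_prod_eq_sum_degree)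

lemma monic_orbit_poly: "lead_coeff (orbit_poly k x) = 1"
  by (simp add: orbit_poly_def lead_coeff_prod)

lemma frob_orbit_poly: assumes "x \<in> Fq k" shows "frob (orbit_poly k x) = orbit_poly k x"
proof -
  let ?g = "\<lambda>i. [:- (x ^ (q ^ i)), 1:]"
  have "(x ^ (q ^ i)) ^ q = x ^ (q ^ Suc i)" for i
    using frob_pow_pow[of x i 1] by simp
  then have "frob (?g i) = ?g (Suc i)" for i
    using frob_minus_pow[of "x ^ (q ^ i)" 1] q_gt_1 by (simp add: frob_pCons frob_0)
  then have "frob (orbit_poly k x) = (\<Prod>i<k. ?g (Suc i))" unfolding orbit_poly_def frob_prod by (rule prod.cong[OF refl])
  moreover have "?g 0 * (\<Prod>i<k. ?g (Suc i)) = (\<Prod>i<k. ?g i) * ?g k"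
    by (rule trans[OF prod.lessThan_Suc_shift[of ?g k, symmetric] prod.lessThan_Suc])
  moreover have "?g k = ?g 0" using assms by (simp add: Fq_def)
  ultimately have "?g 0 * frob (orbit_poly k x) = ?g 0 * orbit_poly k x" by (simp only: orbit_poly_def mult.commute)
  then show ?thesis by (metis mult_left_cancel pCons_eq_0_iff one_neq_zero)
qed

lemma norm_f_linear: "norm_f [:- y, 1:] = - poly f y"
proof -
  have "(\<Prod>b\<in>#A. b - y) = (- 1) ^ size A * (\<Prod>b\<in>#A. y - b)" for A :: "'k multiset"
    by (induction A) (simp_all add: algebra_simps)
  from this[of "proots f"] show ?thesis
    by (simp add: norm_f_def poly_f size_roots_f add.commute[of "- y"])
qed

lemma norm_f_prod: "norm_f (\<Prod>i\<in>I. g i) = (\<Prod>i\<in>I. norm_f (g i))"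
proof (induction I rule: infinite_finite_induct)
  case (insert i I) then show ?case by (simp add: norm_f_mult)
qed (simp_all add: norm_f_def)

text \<open>
  The product of the values of \<open>f\<close> at the conjugates of \<open>x\<close> is the norm $f(x)^{1 + q + \dots +
  q^{k-1}}$, and its quadratic character over $\mathbb{F}_q$ is that of $f(x)$ over
  $\mathbb{F}_{q^k}$.
\<close>

lemma chi_orbit_poly:
  assumes "x \<in> Fq k" "k > 0"
  shows "chi (orbit_poly k x) = int (num_sqrts k (poly f x)) - 1"
proof -
  let ?y = "poly f x"
  have "norm_f (orbit_poly k x) = (\<Prod>i<k. - (?y ^ (q ^ i)))"
    by (simp only: orbit_poly_def norm_f_prod norm_f_linear poly_frob_pow[OF frob_f])
  also have "\<dots> = (- 1) ^ k * ?y ^ (\<Sum>i<k. q ^ i)"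
    by (induction k) (simp_all add: power_add)
  finally have 1: "(- 1) ^ k * norm_f (orbit_poly k x) = ?y ^ (\<Sum>i<k. q ^ i)"
    by simp
  obtain l where l: "q = Suc l" using q_gt_1 by (cases q) auto
  have "l * (\<Sum>i<k. q ^ i) + 1 = q ^ k"
    unfolding l by (induction k) (simp_all add: distrib_left)
  then have "(q - 1) * (\<Sum>i<k. q ^ i) = q ^ k - 1" using l by simp
  moreover have h: "2 * ((q - 1) div 2) = q - 1" using half_double[of 1] by simp
  ultimately have "2 * ((\<Sum>i<k. q ^ i) * ((q - 1) div 2)) = 2 * ((q ^ k - 1) div 2)"
    using half_double[OF assms(2)] h by (metis mult.assoc mult.commute)
  then have "chi (orbit_poly k x) = unit_sign (?y ^ ((q ^ k - 1) div 2))"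
    unfolding chi_def degree_orbit_poly 1 by (simp flip: power_mult)
  then show ?thesis
    using num_sqrts_eq_unit_sign[OF poly_in_Fq[OF frob_f assms(1)] assms(2)] by simp
qed

text \<open>
  The summand is the quadratic character of $\mathbb{F}_{q^k}$ at $f(x)$, so that
  $y^2 = f(x)$ has $q^k$ plus this sum many affine points.
\<close>

definition char_sum :: "nat \<Rightarrow> int" where
  "char_sum k = (\<Sum>x\<in>Fq k. int (num_sqrts k (poly f x)) - 1)"

definition chi_sum :: "nat \<Rightarrow> int" where
  "chi_sum n = (\<Sum>h\<in>monics n. chi h)"

lemma chi_sum_0: "chi_sum 0 = 1"
proof -
  have "monics 0 = {1}"
    by (auto simp: monics_def frob_1[unfolded one_pCons] one_pCons elim!: degree_eq_zeroE)
  moreover have "chi 1 = 1" by (simp add: chi_def norm_f_def unit_sign_def)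
  ultimately show ?thesis by (simp add: chi_sum_def)
qed

lemma orbit_poly_add: "x \<in> Fq k \<Longrightarrow> orbit_poly (k + l) x = orbit_poly k x * orbit_poly l x"
proof -
  assume "x \<in> Fq k"
  then have "x ^ (q ^ (k + i)) = x ^ (q ^ i)" for i
    by (simp add: Fq_def flip: frob_pow_pow)
  then show ?thesis
    by (simp add: orbit_poly_def lessThan_atLeast0 prod.atLeastLessThan_concat[symmetric, of 0 k "k + l"]
       prod.atLeastLessThan_shift_0[of _ k] add.commute)
qed

lemma Fq_mult: "x \<in> Fq d \<Longrightarrow> x \<in> Fq (d * j)"
proof (induction j)
  case (Suc j)
  then have "(x ^ (q ^ d)) ^ (q ^ (d * j)) = x" by (simp add: Fq_def)
  then show ?case by (simp only: frob_pow_pow Fq_def mult_Suc_right mem_Collect_eq)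
qed (simp add: Fq_def)

lemma orbit_poly_mult: "x \<in> Fq d \<Longrightarrow> orbit_poly (d * j) x = orbit_poly d x ^ j"
proof (induction j)
  case 0 then show ?case by (simp add: orbit_poly_def)
next
  case (Suc j) then show ?case using orbit_poly_add[of x d "d * j"] by simp
qed

text \<open>
  The orbit of a root of a polynomial over $\mathbb{F}_q$ under the injective $q$-th power map
  consists of roots of the same polynomial. Hence it is finite and purely periodic.
\<close>

lemma period_exists:
  assumes "frob h = h" "h \<noteq> 0" "poly h x = 0"
  obtains d where "d > 0" "\<And>k. x \<in> Fq k \<longleftrightarrow> d dvd k"
    "\<And>i j. i < d \<Longrightarrow> j < d \<Longrightarrow> x ^ (q ^ i) = x ^ (q ^ j) \<Longrightarrow> i = j"
proof -
  have "finite {y. poly h y = 0}" using assms(2) by (rule poly_roots_finite)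
  moreover have "range (\<lambda>i. x ^ (q ^ i)) \<subseteq> {y. poly h y = 0}"
    using assms q_gt_1 by (auto simp: poly_frob_pow)
  ultimately have "\<not> inj (\<lambda>i. x ^ (q ^ i))"
    by (meson finite_subset infinite_UNIV_nat finite_imageD)
  then obtain i j where "i < j" "x ^ (q ^ i) = x ^ (q ^ j)"
    by (metis injI linorder_less_linear)
  then have "(x ^ (q ^ (j - i))) ^ (q ^ i) = x ^ (q ^ i)" by (simp add: frob_pow_pow)
  then have ex: "x \<in> Fq (j - i) \<and> j - i > 0"
    using \<open>i < j\<close> by (simp add: frob_inj_pow Fq_def)
  define d where "d = (LEAST k. x \<in> Fq k \<and> k > 0)"
  have d: "x \<in> Fq d" "d > 0" using LeastI[of "\<lambda>k. x \<in> Fq k \<and> k > 0", OF ex] by (auto simp: d_def)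
  have least: "k = 0" if "x \<in> Fq k" "k < d" for k
    using not_less_Least[of k "\<lambda>k. x \<in> Fq k \<and> k > 0"] that by (auto simp: d_def)
  have "x \<in> Fq k \<longleftrightarrow> d dvd k" for k
  proof
    assume "x \<in> Fq k"
    have "x ^ (q ^ k) = (x ^ (q ^ (d * (k div d)))) ^ (q ^ (k mod d))"
      by (simp only: frob_pow_pow mult_div_mod_eq)
    also have "\<dots> = x ^ (q ^ (k mod d))"
      using Fq_mult[OF d(1)] by (simp add: Fq_def)
    finally have "x \<in> Fq (k mod d)" using \<open>x \<in> Fq k\<close> by (simp add: Fq_def)
    with least[of "k mod d"] d show "d dvd k" by (simp add: dvd_eq_mod_eq_0)
  qed (use Fq_mult[OF d(1)] in auto)
  moreover have "i = j" if ij: "i < d" "j < d" "x ^ (q ^ i) = x ^ (q ^ j)" for i j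
  proof -
    have *: False if "i < j" "j < d" "x ^ (q ^ i) = x ^ (q ^ j)" for i j
    proof -
      have "x ^ (q ^ (i + (d - j))) = x ^ (q ^ (j + (d - j)))"
        using that(3) by (simp only: frob_pow_pow[symmetric])
      then have 1: "x \<in> Fq (i + (d - j))" using that d(1) by (simp add: Fq_def)
      have 2: "i + (d - j) < d" and 3: "i + (d - j) \<noteq> 0" using that by linarith+
      from 3 least[OF 1 2] show False by contradiction
    qed
    from *[of i j] *[of j i] ij show ?thesis by (metis linorder_neqE_nat)
  qed
  ultimately show thesis using that d(2) by blast
qed

lemma linear_prod_dvd:
  fixes h :: "'k poly"
  assumes "finite I" "inj_on g I" "\<And>i. i \<in> I \<Longrightarrow> poly h (g i) = 0"
  shows "(\<Prod>i\<in>I. [:- g i, 1:]) dvd h"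
  using assms
proof (induction I arbitrary: h rule: finite_induct)
  case (insert i I)
  then have "[:- g i, 1:] dvd h" by (simp add: poly_eq_0_iff_dvd[symmetric])
  then obtain h' where h': "h = [:- g i, 1:] * h'" ..
  have "poly h' (g j) = 0" if "j \<in> I" for j
  proof -
    have "g j \<noteq> g i" using insert.hyps insert.prems(1) that by (auto simp: inj_on_def)
    with insert.prems(2)[of j] that show ?thesis by (simp add: h')
  qed
  with insert.IH[of h'] insert.prems(1) have "(\<Prod>i\<in>I. [:- g i, 1:]) dvd h'" by (simp add: inj_on_insert)
  then show ?case using insert.hyps by (simp add: h' del: mult_pCons_left)
qed simp

text \<open>
  The polynomial \<open>orbit_poly d x\<close> is the minimal polynomial of \<open>x\<close>: it has simple roots, and it
  divides every polynomial over $\mathbb{F}_q$ that vanishes at \<open>x\<close>.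
\<close>

lemma orbit_poly_power_dvd_iff:
  assumes h: "frob h = h" "h \<noteq> 0" and x: "x \<in> Fq d" and d: "d > 0"
    and inj: "\<And>i j. i < d \<Longrightarrow> j < d \<Longrightarrow> x ^ (q ^ i) = x ^ (q ^ j) \<Longrightarrow> i = j"
  shows "orbit_poly d x ^ j dvd h \<longleftrightarrow> j \<le> Polynomial.order x h"
proof -
  have ord: "Polynomial.order x (orbit_poly d x) = 1"
  proof -
    obtain e where e: "d = Suc e" using d by (cases d) auto
    let ?P = "\<Prod>i<e. [:- (x ^ (q ^ Suc i)), 1:]"
    have orbit_poly: "orbit_poly d x = [:- x, 1:] ^ 1 * ?P"
      unfolding orbit_poly_def e prod.lessThan_Suc_shift by simp
    have "x \<noteq> x ^ (q ^ Suc i)" if "i < e" for i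
      using inj[of "Suc i" 0] that by (auto simp: e)
    then have "poly ?P x \<noteq> 0" by (simp add: poly_prod del: power_Suc)
    then have 1: "Polynomial.order x ?P = 0" by (rule order_0I)
    have 2: "Polynomial.order x ([:- x, 1:] ^ 1) = 1" by (rule order_power_n_n)
    have nz: "[:- x, 1:] ^ 1 * ?P \<noteq> 0" using orbit_poly_neq_0[of d x] orbit_poly by (simp only: not_False_eq_True)
    show ?thesis unfolding orbit_poly using order_mult[OF nz, of x] 1 2 by linarith
  qed
  show ?thesis
  proof
    assume "orbit_poly d x ^ j dvd h"
    then have "Polynomial.order x (orbit_poly d x ^ j) \<le> Polynomial.order x h"
      using h(2) by (intro dvd_imp_order_le)
    moreover have "Polynomial.order x (orbit_poly d x ^ j) = j"
      using orbit_poly_neq_0 by (induction j) (simp_all add: order_mult ord)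
    ultimately show "j \<le> Polynomial.order x h" by simp
  next
    show "j \<le> Polynomial.order x h \<Longrightarrow> orbit_poly d x ^ j dvd h"
      using h
    proof (induction j arbitrary: h)
      case (Suc j)
      then have root: "poly h x = 0" by (simp add: order_root)
      have "orbit_poly d x dvd h"
        unfolding orbit_poly_def using Suc.prems inj root q_gt_1
        by (intro linear_prod_dvd) (auto simp: inj_on_def poly_frob_pow)
      then obtain h' where h': "h = orbit_poly d x * h'" ..
      with Suc.prems have "frob h' = h'" "h' \<noteq> 0"
        using rational_cancel[of "orbit_poly d x" h'] frob_orbit_poly[OF x] by (auto simp: orbit_poly_neq_0)
      moreover have "j \<le> Polynomial.order x h'"
        using Suc.prems h' by (simp add: order_mult ord)
      ultimately show ?case using Suc.IH[of h'] by (simp add: h')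
    qed simp
  qed
qed

text \<open>
  If \<open>x\<close> is a root of \<open>h\<close> of multiplicity $e$ and $d$ is its degree over $\mathbb{F}_q$, then the
  admissible \<open>k\<close> are $d, 2d, \dots, ed$. So the pairs count the roots of \<open>h\<close> with multiplicity. This is
  the combinatorial content of the logarithmic derivative of the Euler product of the
  $L$-function.
\<close>

lemma card_orbit_poly_dvd:
  assumes h: "frob h = h" "h \<noteq> 0"
  shows "card {(k, x). k > 0 \<and> x \<in> Fq k \<and> orbit_poly k x dvd h} = Polynomial.degree h"
    and "finite {(k, x). k > 0 \<and> x \<in> Fq k \<and> orbit_poly k x dvd h}"
proof -
  let ?Z = "{x. poly h x = 0}"
  let ?K = "\<lambda>x. {k. k > 0 \<and> x \<in> Fq k \<and> orbit_poly k x dvd h}"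
  have finZ: "finite ?Z" using h(2) by (rule poly_roots_finite)
  have K: "finite (?K x)" "card (?K x) = Polynomial.order x h" if "x \<in> ?Z" for x
  proof -
    from that have "poly h x = 0" by simp
    from period_exists[OF h this] obtain d where d: "d > 0" "\<And>k. x \<in> Fq k \<longleftrightarrow> d dvd k"
      "\<And>i j. i < d \<Longrightarrow> j < d \<Longrightarrow> x ^ (q ^ i) = x ^ (q ^ j) \<Longrightarrow> i = j" by blast
    have x: "x \<in> Fq d" using d(2)[of d] by simp
    have iff: "orbit_poly d x ^ j dvd h \<longleftrightarrow> j \<le> Polynomial.order x h" for j
      using orbit_poly_power_dvd_iff[OF h x d(1)] d(3) by metis
    have "?K x = (\<lambda>j. d * j) ` {1..Polynomial.order x h}"
    proof (intro equalityI subsetI)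
      fix k assume k: "k \<in> ?K x"
      then obtain j where j: "k = d * j" using d(2) by auto
      from k have "orbit_poly k x dvd h" by blast
      then have "orbit_poly d x ^ j dvd h" by (simp only: j orbit_poly_mult[OF x])
      then have "j \<le> Polynomial.order x h" by (rule iffD1[OF iff])
      moreover have "j \<ge> 1" using j k by (cases j) auto
      ultimately show "k \<in> (\<lambda>j. d * j) ` {1..Polynomial.order x h}" using j by auto
    next
      fix k assume "k \<in> (\<lambda>j. d * j) ` {1..Polynomial.order x h}"
      then obtain j where j: "k = d * j" "1 \<le> j" "j \<le> Polynomial.order x h"
        by (elim imageE) auto
      from j(3) have "orbit_poly d x ^ j dvd h" by (rule iffD2[OF iff])
      then have "orbit_poly k x dvd h" by (simp only: j(1) orbit_poly_mult[OF x])
      moreover have "x \<in> Fq k" using d(2)[of k] j(1) by simp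
      moreover have "k > 0" using j d(1) by simp
      ultimately show "k \<in> ?K x" by blast
    qed
    moreover have "inj_on (\<lambda>j. d * j) {1..Polynomial.order x h}" using d(1) by (auto simp: inj_on_def)
    ultimately show "finite (?K x)" "card (?K x) = Polynomial.order x h" by (simp_all add: card_image)
  qed
  have root: "poly h x = 0" if "k > 0" "orbit_poly k x dvd h" for k x
  proof -
    have "[:- x, 1:] dvd orbit_poly k x"
      unfolding orbit_poly_def using that(1) by (intro dvd_prodI[of _ 0 "\<lambda>i. [:- (x ^ (q ^ i)), 1:]", simplified]) auto
    with that show ?thesis by (metis dvd_trans poly_eq_0_iff_dvd)
  qed
  have eq: "{(k, x). k > 0 \<and> x \<in> Fq k \<and> orbit_poly k x dvd h} = prod.swap ` (SIGMA x:?Z. ?K x)"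
    using root by (auto simp: image_iff)
  show "finite {(k, x). k > 0 \<and> x \<in> Fq k \<and> orbit_poly k x dvd h}"
    unfolding eq using finZ K by blast
  show "card {(k, x). k > 0 \<and> x \<in> Fq k \<and> orbit_poly k x dvd h} = Polynomial.degree h"
    unfolding eq using finZ K sum_order_roots[OF h(2)] by (subst card_image) simp_all
qed

text \<open>
  Weight each monic \<open>h\<close> of degree \<open>n\<close> by the number \<open>n\<close> of its pairs in \<open>card_orbit_poly_dvd\<close>, and
  write $h = g \cdot{}$\<open>orbit_poly k x\<close>.
\<close>

lemma newton_identity:
  "int n * chi_sum n = (\<Sum>k=1..n. char_sum k * chi_sum (n - k))"
proof -
  let ?A = "\<lambda>h. {(k, x). k > 0 \<and> x \<in> Fq k \<and> orbit_poly k x dvd h}"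
  have A: "card (?A h) = n" "finite (?A h)" "frob h = h" "h \<noteq> 0" if "h \<in> monics n" for h
  proof -
    show h: "frob h = h" "h \<noteq> 0" using that by (auto simp: monics_def)
    show "card (?A h) = n" "finite (?A h)" using card_orbit_poly_dvd[OF h] that by (auto simp: monics_def)
  qed
  have "int n * chi_sum n = (\<Sum>h\<in>monics n. \<Sum>y\<in>?A h. chi h)"
    using A by (simp add: chi_sum_def sum_distrib_left)
  also have "\<dots> = (\<Sum>(h, y)\<in>(SIGMA h:monics n. ?A h). chi h)"
    using A finite_monics by (subst sum.Sigma) auto
  also have "\<dots> = (\<Sum>(k, x, g)\<in>(SIGMA k:{1..n}. SIGMA x:Fq k. monics (n - k)). chi (orbit_poly k x) * chi g)"
  proof (rule sum.reindex_bij_witness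
      [where j = "\<lambda>(h, k, x). (k, x, h div orbit_poly k x)" and i = "\<lambda>(k, x, g). (orbit_poly k x * g, k, x)"])
    fix a assume "a \<in> (SIGMA h:monics n. ?A h)"
    then obtain h k x where a: "a = (h, k, x)" and h: "h \<in> monics n" "k > 0" "x \<in> Fq k" "orbit_poly k x dvd h"
      by auto
    from h(4) obtain g where g: "h = orbit_poly k x * g" ..
    have div: "h div orbit_poly k x = g" using g orbit_poly_neq_0 by simp
    have fg: "frob g = g" "g \<noteq> 0"
      using rational_cancel[of "orbit_poly k x" g] A[OF h(1)] frob_orbit_poly[OF h(3)] g by (auto simp: orbit_poly_neq_0)
    have deg: "n = k + Polynomial.degree g" "lead_coeff g = 1"
      using h(1) g fg orbit_poly_neq_0 monic_orbit_poly[of k x] lead_coeff_mult[of "orbit_poly k x" g] by (auto simp: monics_def degree_mult_eq degree_orbit_poly)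
    show "(case (case a of (h, k, x) \<Rightarrow> (k, x, h div orbit_poly k x)) of (k, x, g) \<Rightarrow> (orbit_poly k x * g, k, x)) = a"
      using a div g by simp
    show "(case a of (h, k, x) \<Rightarrow> (k, x, h div orbit_poly k x)) \<in> (SIGMA k:{1..n}. SIGMA x:Fq k. monics (n - k))"
      using a div h deg fg by (auto simp: monics_def)
    show "(case (case a of (h, k, x) \<Rightarrow> (k, x, h div orbit_poly k x)) of (k, x, g) \<Rightarrow> chi (orbit_poly k x) * chi g) =
        (case a of (h, y) \<Rightarrow> chi h)"
      using a div g chi_mult[of "orbit_poly k x" g] frob_orbit_poly[OF h(3)] orbit_poly_neq_0 fg by simp
  next
    fix b assume "b \<in> (SIGMA k:{1..n}. SIGMA x:Fq k. monics (n - k))"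
    then obtain k x g where b: "b = (k, x, g)" and g: "1 \<le> k" "k \<le> n" "x \<in> Fq k" "g \<in> monics (n - k)"
      by auto
    show "(case (case b of (k, x, g) \<Rightarrow> (orbit_poly k x * g, k, x)) of (h, k, x) \<Rightarrow> (k, x, h div orbit_poly k x)) = b"
      using b orbit_poly_neq_0 by simp
    have "g \<noteq> 0" using g(4) by (auto simp: monics_def)
    then have "orbit_poly k x * g \<in> monics n"
      using g monic_orbit_poly[of k x] lead_coeff_mult[of "orbit_poly k x" g]
      by (auto simp: monics_def degree_mult_eq orbit_poly_neq_0 degree_orbit_poly frob_mult frob_orbit_poly)
    then show "(case b of (k, x, g) \<Rightarrow> (orbit_poly k x * g, k, x)) \<in> (SIGMA h:monics n. ?A h)"
      using b g by auto
  qed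
  also have "\<dots> = (\<Sum>k=1..n. \<Sum>x\<in>Fq k. \<Sum>g\<in>monics (n - k). chi (orbit_poly k x) * chi g)"
    using finite_Fq finite_monics by (subst sum.Sigma[symmetric]) (auto simp: sum.Sigma[symmetric])
  also have "\<dots> = (\<Sum>k=1..n. char_sum k * chi_sum (n - k))"
    using chi_orbit_poly by (intro sum.cong refl) (simp add: char_sum_def chi_sum_def sum_product)
  finally show ?thesis .
qed

end

section \<open>The degree of the \<open>L\<close>-polynomial and its leading coefficient\<close>

context cubic_over_finite begin

text \<open>
  The polynomial $X^{(q-1)/2} - 1$ has fewer than $q - 1$ roots.
\<close>

lemma nonsquare_exists: obtains c where "c \<in> Fq 1" "c ^ ((q - 1) div 2) = - 1"
proof -
  let ?e = "(q - 1) div 2"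
  let ?p = "Polynomial.monom 1 ?e - [:1 :: 'k:]"
  have e: "?e > 0" "2 * ?e = q - 1" using half_pos[of 1] half_double[of 1] by simp_all
  have deg: "Polynomial.degree ?p = ?e"
    using e by (simp add: degree_add_eq_left degree_monom_eq diff_conv_add_uminus del: add_uminus_conv_diff)
  with e have "?p \<noteq> 0" by auto
  then have "card {x. poly ?p x = 0} \<le> ?e" "finite {x. poly ?p x = 0}"
    using deg card_poly_roots_bound[of ?p] poly_roots_finite[of ?p] by simp_all
  moreover have "card (Fq 1 - {0}) = q - 1"
    using card_Fq[of 1] finite_Fq[of 1] Fq_closed(1)[of 1] by simp
  ultimately have "\<not> Fq 1 - {0} \<subseteq> {x. poly ?p x = 0}"
    using card_mono[of "{x. poly ?p x = 0}" "Fq 1 - {0}"] e by linarith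
  then obtain c where c: "c \<in> Fq 1" "c \<noteq> 0" "c ^ ?e \<noteq> 1" by (auto simp: poly_monom)
  with half_power_cases[OF c(1)] have "c ^ ?e = - 1" by auto
  with c(1) show thesis by (rule that)
qed

text \<open>
  Let \<open>c\<close> be a non-square. Replacing \<open>h\<close> by $ch + (1 - c) f X^{n-3}$ keeps it monic and multiplies
  its values at the three roots of \<open>f\<close> by \<open>c\<close>. As $c^3$ is a non-square, the sign of \<open>chi\<close> changes.
\<close>

lemma chi_sum_ge_3: assumes "n \<ge> 3" shows "chi_sum n = 0"
proof -
  obtain c where c: "c \<in> Fq 1" "c ^ ((q - 1) div 2) = - 1" by (rule nonsquare_exists)
  then have c0: "c \<noteq> 0" using half_pos[of 1] by (auto simp: power_0_left)
  define F where "F = f * Polynomial.monom 1 (n - 3)"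
  have "Polynomial.degree F = n" "frob F = F"
    using assms degree_f f_neq_0
    by (simp_all add: F_def degree_mult_eq degree_monom_eq frob_mult frob_f frob_monom)
  moreover have "lead_coeff F = 1"
    unfolding F_def lead_coeff_mult monic_f by (simp add: degree_monom_eq)
  ultimately have F: "Polynomial.degree F = n" "lead_coeff F = 1" "frob F = F" by blast+
  \<comment> \<open>The inverse of \<open>\<phi> c\<close> is \<open>\<phi> (1 / c)\<close>; the multiple of \<open>f\<close> only restores the leading coefficient.\<close>
  define \<phi> where "\<phi> = (\<lambda>a h. Polynomial.smult a h + Polynomial.smult (1 - a) F)"
  have monics: "\<phi> a h \<in> monics n" if "a \<in> Fq 1" "h \<in> monics n" for a h
  proof -
    have "a ^ q = a" "(1 - a) ^ q = 1 - a"
      using that(1) Fq_closed(4)[OF Fq_closed(2) that(1)] by (simp_all only: Fq_1)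
    then have "frob (\<phi> a h) = \<phi> a h"
      using that(2) F by (simp add: \<phi>_def frob_plus frob_smult monics_def)
    moreover have "coeff (\<phi> a h) n = 1"
      using that F by (auto simp: \<phi>_def monics_def)
    moreover have "Polynomial.degree (\<phi> a h) \<le> n"
      using that F by (auto simp: \<phi>_def monics_def intro!: degree_add_le order_trans[OF degree_smult_le])
    ultimately show ?thesis
      by (simp add: monics_def) (metis le_antisym le_degree zero_neq_one)
  qed
  have inverse: "\<phi> a (\<phi> (1 / a) h) = h" if "a \<noteq> 0" for a h
  proof (rule poly_eqI)
    fix i show "coeff (\<phi> a (\<phi> (1 / a) h)) i = coeff h i"
      using that by (simp add: \<phi>_def field_simps)
  qed
  have "norm_f (\<phi> c h) = c ^ 3 * norm_f h" for h
  proof -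
    have "norm_f (\<phi> c h) = (\<Prod>b\<in>#proots f. c * poly h b)"
      unfolding norm_f_def
      by (intro arg_cong[of _ _ prod_mset] image_mset_cong) (use f_neq_0 in \<open>simp add: \<phi>_def F_def\<close>)
    also have "\<dots> = c ^ size (proots f) * norm_f h"
      by (simp add: prod_mset.distrib norm_f_def prod_mset_constant)
    finally show ?thesis by (simp add: size_roots_f)
  qed
  moreover have "(c ^ 3) ^ ((q - 1) div 2) = - 1"
    using c(2) by (metis mult.commute power_mult odd_numeral power_minus_odd power_one)
  ultimately have power_neg: "((- 1) ^ n * norm_f (\<phi> c h)) ^ ((q - 1) div 2) = - (((- 1) ^ n * norm_f h) ^ ((q - 1) div 2))" for h
    by (simp add: power_mult_distrib)
  have "chi (\<phi> c h) = - chi h" if "h \<in> monics n" for h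
  proof -
    let ?z = "((- 1) ^ n * norm_f h) ^ ((q - 1) div 2)"
    have "?z \<in> {0, 1, - 1}" using that by (intro chi_arg_cases) (simp add: monics_def)
    then have "unit_sign (- ?z) = - unit_sign ?z"
      using one_neq_minus_1 by (auto simp: unit_sign_def)
    moreover have "Polynomial.degree (\<phi> c h) = n" "Polynomial.degree h = n"
      using monics[OF c(1) that] that by (simp_all add: monics_def)
    ultimately show ?thesis by (simp only: chi_def power_neg)
  qed
  moreover have "(\<Sum>h\<in>monics n. chi (\<phi> c h)) = chi_sum n"
    unfolding chi_sum_def
    by (rule sum.reindex_bij_witness[where j = "\<phi> c" and i = "\<phi> (1 / c)"])
      (use c0 c(1) inverse[of c] inverse[of "1 / c"] monics Fq_closed(2)[of 1] Fq_closed(6)[of 1 1 c] in auto)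
  ultimately have "chi_sum n = - chi_sum n" by (simp add: sum_negf chi_sum_def)
  then show ?thesis by simp
qed

text \<open>
  A monic cubic over $\mathbb{F}_q$ has as many monic quadratic divisors over $\mathbb{F}_q$ as monic
  linear ones, the complementary divisors. The quadratic divisors are the products of two distinct
  roots in $\mathbb{F}_q$, the squares belonging to multiple roots, and the minimal polynomials of the
  roots in $\mathbb{F}_{q^2} \setminus \mathbb{F}_q$; hence
  $n_1 = \frac{n_1 (n_1 - 1)}{2} + d_1 + \frac{n_2 - n_1}{2}$.
\<close>

lemma cubic_root_count:
  assumes g: "frob g = g" "Polynomial.degree g = 3" "lead_coeff g = 1"
  defines "n1 \<equiv> card {x \<in> Fq 1. poly g x = 0}"
    and "n2 \<equiv> card {x \<in> Fq 2. poly g x = 0}"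
    and "d1 \<equiv> card {x \<in> Fq 1. poly g x = 0 \<and> poly (pderiv g) x = 0}"
  shows "n2 + n1 ^ 2 + 2 * d1 = 4 * n1"
proof (cases "\<exists>a\<in>Fq 1. poly g a = 0")
  case False
  have "poly g x \<noteq> 0" if "x \<in> Fq 2" for x
  proof
    assume root: "poly g x = 0"
    with False have x1: "x \<notin> Fq 1" by blast
    have "poly g (x ^ (q ^ i)) = 0" for i using root q_gt_1 g(1) by (simp add: poly_frob_pow)
    moreover have "inj_on (\<lambda>i. x ^ (q ^ i)) {..<2}"
      using x1 unfolding Fq_1 by (auto simp: inj_on_def less_2_cases_iff)
    ultimately have "orbit_poly 2 x dvd g" unfolding orbit_poly_def by (intro linear_prod_dvd) auto
    then obtain l where l: "g = orbit_poly 2 x * l" ..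
    have l0: "l \<noteq> 0" using l g(2) by auto
    have "Polynomial.degree l = 1" using g(2) l l0 by (simp add: degree_mult_eq orbit_poly_neq_0 degree_orbit_poly)
    moreover have "lead_coeff l = 1" using g(3) l monic_orbit_poly[of 2 x] by (simp add: lead_coeff_mult)
    ultimately have l1: "l = [:coeff l 0, 1:]"
      by (intro poly_eqI) (auto simp: coeff_pCons coeff_eq_0 split: nat.split)
    have "frob l = l" using rational_cancel[of "orbit_poly 2 x" l] l g(1) frob_orbit_poly[OF that] orbit_poly_neq_0 by auto
    then have "- coeff l 0 \<in> Fq 1" using Fq_1_coeff Fq_closed(7) by blast
    moreover have "poly l (- coeff l 0) = 0" by (subst l1) simp
    then have "poly g (- coeff l 0) = 0" by (simp add: l)
    ultimately show False using False by blast
  qed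
  with False have "{x \<in> Fq 2. poly g x = 0} = {}" "{x \<in> Fq 1. poly g x = 0} = {}"
    "{x \<in> Fq 1. poly g x = 0 \<and> poly (pderiv g) x = 0} = {}" by auto
  then have "n1 = 0" "n2 = 0" "d1 = 0" unfolding n1_def n2_def d1_def by (simp_all only: card.empty)
  then show ?thesis by simp
next
  case True
  then obtain a where a: "a \<in> Fq 1" "poly g a = 0" by blast
  then obtain k where k: "g = [:- a, 1:] * k" by (auto simp: poly_eq_0_iff_dvd elim: dvdE)
  have k0: "k \<noteq> 0" using k g(2) by auto
  have degk: "Polynomial.degree k = 2"
    using g(2) k k0 degree_mult_eq[of "[:- a, 1:]" k] by simp
  obtain b where "poly k b = 0" using alg_closed_imp_poly_has_root[of k] degk by auto
  then obtain l where l: "k = [:- b, 1:] * l" by (auto simp: poly_eq_0_iff_dvd elim: dvdE)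
  have l0: "l \<noteq> 0" using k0 l by auto
  have degl: "Polynomial.degree l = 1"
    using degk l l0 degree_mult_eq[of "[:- b, 1:]" l] by simp
  have leadl: "lead_coeff l = 1"
    using g(3) lead_coeff_mult[of "[:- a, 1:]" k] lead_coeff_mult[of "[:- b, 1:]" l] unfolding k l by simp
  define c where "c = - coeff l 0"
  have l1: "l = [:- c, 1:]"
    using degl leadl by (intro poly_eqI) (auto simp: c_def coeff_pCons coeff_eq_0 split: nat.split)
  have gabc: "g = [:- a, 1:] * ([:- b, 1:] * [:- c, 1:])" using k l l1 by simp
  have roots: "poly g x = 0 \<longleftrightarrow> x = a \<or> x = b \<or> x = c" for x
    unfolding gabc poly_mult by simp
  have deriv: "poly (pderiv g) x = (x - b) * (x - c) + (x - a) * (x - c) + (x - a) * (x - b)" for x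
    unfolding gabc pderiv_mult by (simp add: pderiv_pCons algebra_simps)
  have "a ^ q = a" using a(1) by (simp only: Fq_1)
  then have 1: "frob [:- a, 1:] = [:- a, 1:]"
    using frob_minus_pow[of a 1] by (simp add: frob_pCons frob_0)
  have "frob ([:- a, 1:] * k) = [:- a, 1:] * k" using g(1) by (simp only: k)
  from rational_cancel[OF this 1] have fk: "frob k = k" by simp
  have "coeff k 1 = - (b + c)" unfolding l l1 by simp
  with Fq_1_coeff[OF fk, of 1] have "- (b + c) \<in> Fq 1" by (simp only:)
  from Fq_closed(7)[OF this] have s: "b + c \<in> Fq 1" by (simp only: minus_minus)
  have a2: "a \<in> Fq 2" using a(1) by (rule Fq_1_subset)
  show ?thesis
  proof (cases "b \<in> Fq 1")
    case b: True
    have c: "c \<in> Fq 1" using Fq_closed(4)[OF s b] by simp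
    have "{x \<in> Fq 1. poly g x = 0} = {a, b, c}" "{x \<in> Fq 2. poly g x = 0} = {a, b, c}"
      using roots a b c Fq_1_subset by auto
    moreover have "{x \<in> Fq 1. poly g x = 0 \<and> poly (pderiv g) x = 0} =
        (if a = b \<or> a = c then {a} else if b = c then {b} else {})"
      using a b c unfolding roots deriv by auto
    ultimately have N: "n1 = card {a, b, c}" "n2 = card {a, b, c}"
      "d1 = card (if a = b \<or> a = c then {a} else if b = c then {b} else {})"
      unfolding n1_def n2_def d1_def by (simp_all only:)
    show ?thesis unfolding N
      by (cases "a = b"; cases "a = c"; cases "b = c") (simp_all add: power2_eq_square insert_commute)
  next
    case b: False
    have "poly k (b ^ q) = 0" using poly_frob[OF fk, of b] q_gt_1 \<open>poly k b = 0\<close> by simp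
    moreover have "b ^ q \<noteq> b" using b by (simp only: Fq_1 not_False_eq_True)
    ultimately have bq: "b ^ q = c" unfolding l l1 poly_mult by simp
    have "(b + c) ^ q = b + c" using s by (simp only: Fq_1)
    then have cq: "c ^ q = b" using bq by (simp add: frob_add add.commute)
    have bc: "b \<in> Fq 2" "c \<in> Fq 2" using bq cq by (simp_all add: Fq_def power2_eq_square power_mult)
    have c: "c \<notin> Fq 1" using b Fq_closed(4)[OF s, of c] by auto
    have ne: "b \<noteq> c" "a \<noteq> b" "a \<noteq> c" using \<open>b ^ q \<noteq> b\<close> bq a b c by auto
    have "{x \<in> Fq 1. poly g x = 0} = {a}" "{x \<in> Fq 2. poly g x = 0} = {a, b, c}"
      using roots a a2 b c bc by auto
    moreover have "{x \<in> Fq 1. poly g x = 0 \<and> poly (pderiv g) x = 0} = {}"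
      using a b c ne unfolding roots deriv by auto
    ultimately have N: "n1 = card {a}" "n2 = card {a, b, c}" "d1 = card ({} :: 'k set)"
      unfolding n1_def n2_def d1_def by (simp_all only:)
    show ?thesis unfolding N using ne by simp
  qed
qed

end

lemma card_Collect_bij_betw:
  assumes "bij_betw \<phi> P Y"
  shows "card {p \<in> P. A (\<phi> p)} = card {y \<in> Y. A y}"
proof (rule bij_betw_same_card)
  show "bij_betw \<phi> {p \<in> P. A (\<phi> p)} {y \<in> Y. A y}"
    using assms by (auto simp: bij_betw_def inj_on_def)
qed

lemma sum_card_swap:
  assumes "finite P" "finite B"
  shows "(\<Sum>p\<in>P. card {x \<in> B. A p x}) = (\<Sum>x\<in>B. card {p \<in> P. A p x})"
proof -
  have "(\<Sum>p\<in>P. card {x \<in> B. A p x}) = (\<Sum>p\<in>P. \<Sum>x\<in>B. of_bool (A p x))"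
    using assms by (simp add: Int_def)
  also have "\<dots> = (\<Sum>x\<in>B. \<Sum>p\<in>P. of_bool (A p x))" by (rule sum.swap)
  also have "\<dots> = (\<Sum>x\<in>B. card {p \<in> P. A p x})"
    using assms by (simp add: Int_def)
  finally show ?thesis .
qed

context cubic_over_finite begin

abbreviation line :: "'k \<times> 'k \<Rightarrow> 'k \<Rightarrow> 'k" where
  "line p x \<equiv> fst p * x + snd p"

lemma bij_slope_value:
  assumes "x \<in> Fq 1"
  shows "bij_betw (\<lambda>p. (fst p, line p x)) (Fq 1 \<times> Fq 1) (Fq 1 \<times> Fq 1)"
  by (rule bij_betw_byWitness[where f' = "\<lambda>p. (fst p, snd p - fst p * x)"])
    (use assms in \<open>auto intro!: Fq_closed(3-5)\<close>)

text \<open>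
  Two points with different abscissas lie on exactly one line $y = cx + d$.
\<close>

lemma bij_two_values:
  assumes "x \<in> Fq 1" "x' \<in> Fq 1" "x \<noteq> x'"
  shows "bij_betw (\<lambda>p. (line p x, line p x')) (Fq 1 \<times> Fq 1) (Fq 1 \<times> Fq 1)"
proof -
  have inj: "inj_on (\<lambda>p. (line p x, line p x')) (Fq 1 \<times> Fq 1)"
  proof (rule inj_onI, clarsimp)
    fix c d c' d' assume eq: "c * x + d = c' * x + d'" "c * x' + d = c' * x' + d'"
    have "(c - c') * (x - x') = (c * x + d) - (c' * x + d') - ((c * x' + d) - (c' * x' + d'))"
      by (simp add: algebra_simps)
    then have "(c - c') * (x - x') = 0" by (simp add: eq)
    with assms(3) have "c = c'" by simp
    with eq show "c = c' \<and> d = d'" by simp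
  qed
  have "(\<lambda>p. (line p x, line p x')) ` (Fq 1 \<times> Fq 1) \<subseteq> Fq 1 \<times> Fq 1"
    using assms by (auto intro!: Fq_closed(3-5))
  with inj show ?thesis
    using finite_Fq[of 1] by (simp add: bij_betw_def endo_inj_surj)
qed

text \<open>
  A point over $\mathbb{F}_{q^2}$ whose abscissa is not in $\mathbb{F}_q$ lies on exactly one line
  over $\mathbb{F}_q$.
\<close>

lemma bij_value_quadratic:
  assumes "x \<in> Fq 2" "x \<notin> Fq 1"
  shows "bij_betw (\<lambda>p. line p x) (Fq 1 \<times> Fq 1) (Fq 2)"
proof -
  have inj: "inj_on (\<lambda>p. line p x) (Fq 1 \<times> Fq 1)"
  proof (rule inj_onI, clarify)
    fix c d c' d' assume cd: "c \<in> Fq 1" "d \<in> Fq 1" "c' \<in> Fq 1" "d' \<in> Fq 1"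
      and eq: "line (c, d) x = line (c', d') x"
    have "c = c'"
    proof (rule ccontr)
      assume "c \<noteq> c'"
      with eq have "x = (d' - d) / (c - c')" by (simp add: field_simps)
      with cd assms(2) show False by (auto intro!: Fq_closed(4,6))
    qed
    with eq show "c = c' \<and> d = d'" by simp
  qed
  have "(\<lambda>p. line p x) ` (Fq 1 \<times> Fq 1) \<subseteq> Fq 2"
    using assms(1) Fq_1_subset by (auto intro!: Fq_closed(3,5))
  moreover have "card ((\<lambda>p. line p x) ` (Fq 1 \<times> Fq 1)) = card (Fq 2)"
    using card_image[OF inj] card_Fq[of 1] card_Fq[of 2]
    by (simp add: card_cartesian_product power2_eq_square)
  ultimately show ?thesis
    using inj card_subset_eq[OF finite_Fq[of 2]] by (simp add: bij_betw_def)
qed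

lemma num_sqrts_cases:
  assumes "z \<in> Fq 1"
  shows "int (num_sqrts 1 z) ^ 2 = 2 * int (num_sqrts 1 z) - of_bool (z = 0)"
    and "z = 0 \<Longrightarrow> num_sqrts 1 z = 1"
    and "int (num_sqrts 2 z) = 2 - of_bool (z = 0)"
proof -
  have "num_sqrts k 0 = 1" if "k > 0" for k
    using num_sqrts_eq_unit_sign[of 0 k] half_pos[OF that] that Fq_closed(1) by (simp add: unit_sign_def power_0_left)
  then have 0: "num_sqrts 1 0 = 1" "num_sqrts 2 0 = 1" by simp_all
  then show "z = 0 \<Longrightarrow> num_sqrts 1 z = 1" by simp
  have r1: "int (num_sqrts 1 z) \<in> {0, 2}" if "z \<noteq> 0"
    using num_sqrts_eq_unit_sign[OF assms] that by (auto simp: unit_sign_def)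
  show "int (num_sqrts 1 z) ^ 2 = 2 * int (num_sqrts 1 z) - of_bool (z = 0)"
    using 0(1) r1 by (cases "z = 0") auto
  show "int (num_sqrts 2 z) = 2 - of_bool (z = 0)"
  proof (cases "z = 0")
    case False
    have "2 * ((q ^ 2 - 1) div 2) = 2 * ((q - 1) * ((q + 1) div 2))"
    proof -
      obtain l where "q = 2 * l + 1" using odd_q by (elim oddE)
      then show ?thesis using half_double[of 2] by (simp add: power2_eq_square algebra_simps)
    qed
    then have "(q ^ 2 - 1) div 2 = (q - 1) * ((q + 1) div 2)" by simp
    moreover have "z ^ (q - 1) = 1" using in_Fq_nonzero[OF False, of 1] assms by simp
    ultimately have "z ^ ((q ^ 2 - 1) div 2) = 1" by (simp add: power_mult)
    with False num_sqrts_eq_unit_sign[OF Fq_1_subset[OF assms], of 2] show ?thesis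
      by (simp add: unit_sign_def)
  qed (simp add: 0)
qed

lemma char_sum_eq: "k > 0 \<Longrightarrow> char_sum k = (\<Sum>x\<in>Fq k. int (num_sqrts k (poly f x))) - int q ^ k"
  by (simp add: char_sum_def sum_subtractf card_Fq)

text \<open>
  Sum the identity of \<open>cubic_root_count\<close> for $f - (cx + d)^2$ over all $q^2$ lines $y = cx + d$, and
  count the incidences point by point. A point over $\mathbb{F}_q$ lies on $q$ of the lines, two
  points with distinct abscissas lie on one, and at a point with $y \ne 0$ one line is tangent. Points
  with $y = 0$ have no tangent of this form because \<open>f\<close> is separable.
\<close>

lemma char_sum_2: "char_sum 2 = 2 * int q - char_sum 1 ^ 2"
proof -
  let ?P = "Fq 1 \<times> Fq 1"
  have fin: "finite (Fq 1)" "finite (Fq 2)" "finite ?P" using finite_Fq by simp_all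
  let ?on = "\<lambda>p x. line p x ^ 2 = poly f x"
  let ?tangent = "\<lambda>p x. ?on p x \<and> poly (pderiv f) x = 2 * (fst p * line p x)"
  define R where "R x = int (num_sqrts 1 (poly f x))" for x
  define Z where "Z x = (of_bool (poly f x = 0) :: int)" for x
  define D where "D = (\<Sum>x\<in>Fq 1. R x)"
  define z where "z = (\<Sum>x\<in>Fq 1. Z x)"
  have f_in_Fq: "poly f x \<in> Fq k" if "x \<in> Fq k" for x k using poly_in_Fq[OF frob_f that] .
  have on1: "int (card {p \<in> ?P. ?on p x}) = int q * R x" if "x \<in> Fq 1" for x
  proof -
    have "card {p \<in> ?P. ?on p x} = card {p \<in> ?P. snd p ^ 2 = poly f x}"
      using card_Collect_bij_betw[OF bij_slope_value[OF that], of "\<lambda>p. snd p ^ 2 = poly f x"] by simp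
    also have "{p \<in> ?P. snd p ^ 2 = poly f x} = Fq 1 \<times> {y \<in> Fq 1. y ^ 2 = poly f x}" by auto
    finally show ?thesis using card_Fq[of 1] by (simp add: card_cartesian_product R_def num_sqrts_def)
  qed
  have on2: "card {p \<in> ?P. ?on p x} = num_sqrts 2 (poly f x)" if "x \<in> Fq 2 - Fq 1" for x
    using card_Collect_bij_betw[OF bij_value_quadratic, of x "\<lambda>y. y ^ 2 = poly f x"] that
    by (simp add: num_sqrts_def)
  have on11: "int (card {p \<in> ?P. ?on p x \<and> ?on p x'}) = R x * R x'"
    if "x \<in> Fq 1" "x' \<in> Fq 1" "x \<noteq> x'" for x x'
  proof -
    have "card {p \<in> ?P. ?on p x \<and> ?on p x'} = card {p \<in> ?P. fst p ^ 2 = poly f x \<and> snd p ^ 2 = poly f x'}"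
      using card_Collect_bij_betw[OF bij_two_values[OF that], of "\<lambda>p. fst p ^ 2 = poly f x \<and> snd p ^ 2 = poly f x'"]
      by simp
    also have "{p \<in> ?P. fst p ^ 2 = poly f x \<and> snd p ^ 2 = poly f x'}
        = {y \<in> Fq 1. y ^ 2 = poly f x} \<times> {y \<in> Fq 1. y ^ 2 = poly f x'}" by auto
    finally show ?thesis by (simp add: card_cartesian_product R_def num_sqrts_def)
  qed
  have frob_deriv: "poly (pderiv f) x \<in> Fq 1" if "x \<in> Fq 1" for x
  proof -
    have "of_nat i \<in> Fq 1" for i by (induction i) (auto intro: Fq_closed(1-3))
    then have "coeff (pderiv f) i \<in> Fq 1" for i
      using Fq_1_coeff[OF frob_f] by (simp only: coeff_pderiv Fq_closed(5))
    then have "frob (pderiv f) = pderiv f" by (intro poly_eqI) (simp only: coeff_frob Fq_1)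
    from poly_in_Fq[OF this that] show ?thesis .
  qed
  have tan: "int (card {p \<in> ?P. ?tangent p x}) = R x - Z x" if "x \<in> Fq 1" for x
  proof -
    have "card {p \<in> ?P. ?tangent p x}
        = card {p \<in> ?P. snd p ^ 2 = poly f x \<and> poly (pderiv f) x = 2 * (fst p * snd p)}"
      using card_Collect_bij_betw[OF bij_slope_value[OF that],
          of "\<lambda>p. snd p ^ 2 = poly f x \<and> poly (pderiv f) x = 2 * (fst p * snd p)"] by simp
    \<comment> \<open>At a point with \<open>y \<noteq> 0\<close> the tangent has slope \<open>f' / (2 y)\<close>.\<close>
    also have "\<dots> = (if poly f x = 0 then 0 else num_sqrts 1 (poly f x))"
    proof (cases "poly f x = 0")
      case True
      then have "{p \<in> ?P. snd p ^ 2 = poly f x \<and> poly (pderiv f) x = 2 * (fst p * snd p)} = {}"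
        using separable_f[OF True] by auto
      with True show ?thesis by (simp only: card.empty refl if_True)
    next
      case False
      have two: "(2 :: 'k) \<in> Fq 1" using Fq_closed(3)[OF Fq_closed(2) Fq_closed(2)] by simp
      have "bij_betw (\<lambda>y. (poly (pderiv f) x / (2 * y), y)) {y \<in> Fq 1. y ^ 2 = poly f x}
          {p \<in> ?P. snd p ^ 2 = poly f x \<and> poly (pderiv f) x = 2 * (fst p * snd p)}"
        by (rule bij_betw_byWitness[where f' = snd])
          (use False two_neq_0 frob_deriv[OF that] two in \<open>auto simp: field_simps intro!: Fq_closed(5,6)\<close>)
      with False show ?thesis by (simp add: bij_betw_same_card num_sqrts_def)
    qed
    also have "int \<dots> = R x - Z x"
      using num_sqrts_cases(2)[OF f_in_Fq[OF that]] by (simp add: R_def Z_def)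
    finally show ?thesis .
  qed
  \<comment> \<open>Numbers of intersection points over \<open>F_q\<close> and \<open>F_{q^2}\<close>, and of points of tangency, on one line.\<close>
  define n1 where "n1 p = card {x \<in> Fq 1. ?on p x}" for p
  define n2 where "n2 p = card {x \<in> Fq 2. ?on p x}" for p
  define d1 where "d1 p = card {x \<in> Fq 1. ?tangent p x}" for p
  have count: "n2 p + n1 p ^ 2 + 2 * d1 p = 4 * n1 p" if "p \<in> ?P" for p
  proof -
    let ?v = "[:snd p, fst p:]"
    let ?g = "f - ?v * ?v"
    have "snd p ^ q = snd p" "fst p ^ q = fst p" using that unfolding Fq_1[symmetric] by auto
    then have "frob ?v = ?v" by (simp add: frob_pCons frob_0)
    then have 1: "frob ?g = ?g" by (simp only: frob_diff frob_mult frob_f)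
    have dv: "Polynomial.degree (?v * ?v) < 3"
      by (rule le_less_trans[OF degree_mult_le]) simp
    have 2: "Polynomial.degree ?g = 3"
      using degree_add_eq_left[of "- (?v * ?v)" f] dv degree_f
      by (simp only: degree_minus diff_conv_add_uminus)
    have "coeff f 3 = 1" using monic_f degree_f by (simp only:)
    then have 3: "lead_coeff ?g = 1"
      unfolding 2 by (simp only: coeff_diff coeff_eq_0[OF dv] diff_zero)
    have roots: "poly ?g x = 0 \<longleftrightarrow> ?on p x" for x
      by (auto simp: power2_eq_square algebra_simps)
    have deriv: "poly (pderiv ?g) x = 0 \<longleftrightarrow> poly (pderiv f) x = 2 * (fst p * line p x)" for x
      by (simp add: pderiv_diff pderiv_mult pderiv_pCons algebra_simps)
    show ?thesis
      using cubic_root_count[OF 1 2 3] unfolding n1_def n2_def d1_def roots deriv .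
  qed
  have s1: "(\<Sum>p\<in>?P. int (n1 p)) = int q * D"
  proof -
    have "(\<Sum>p\<in>?P. int (n1 p)) = (\<Sum>x\<in>Fq 1. int (card {p \<in> ?P. ?on p x}))"
      using sum_card_swap[OF fin(3,1), of ?on] unfolding n1_def by (simp flip: of_nat_sum)
    then show ?thesis using on1 by (simp add: D_def sum_distrib_left)
  qed
  have sd: "(\<Sum>p\<in>?P. int (d1 p)) = D - z"
  proof -
    have "(\<Sum>p\<in>?P. int (d1 p)) = (\<Sum>x\<in>Fq 1. int (card {p \<in> ?P. ?tangent p x}))"
      using sum_card_swap[OF fin(3,1), of ?tangent] unfolding d1_def by (simp flip: of_nat_sum)
    then show ?thesis using tan by (simp add: D_def z_def sum_subtractf)
  qed
  have s2: "(\<Sum>p\<in>?P. int (n2 p)) = int q * D + char_sum 2 + int q ^ 2 - 2 * int q + z"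
  proof -
    have sub: "Fq 1 \<subseteq> Fq 2" using Fq_1_subset by blast
    have "(\<Sum>p\<in>?P. int (n2 p)) = (\<Sum>x\<in>Fq 2. int (card {p \<in> ?P. ?on p x}))"
      using sum_card_swap[OF fin(3,2), of ?on] unfolding n2_def by (simp flip: of_nat_sum)
    also have "\<dots> = (\<Sum>x\<in>Fq 2 - Fq 1. int (num_sqrts 2 (poly f x))) + (\<Sum>x\<in>Fq 1. int q * R x)"
      using on1 on2 fin by (simp add: sum.subset_diff[OF sub])
    also have "(\<Sum>x\<in>Fq 2 - Fq 1. int (num_sqrts 2 (poly f x)))
        = (\<Sum>x\<in>Fq 2. int (num_sqrts 2 (poly f x))) - (\<Sum>x\<in>Fq 1. 2 - Z x)"
    proof -
      have "(\<Sum>x\<in>Fq 1. int (num_sqrts 2 (poly f x))) = (\<Sum>x\<in>Fq 1. 2 - Z x)"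
        by (intro sum.cong refl) (simp only: num_sqrts_cases(3)[OF f_in_Fq] Z_def)
      then show ?thesis by (simp only: sum_diff[OF fin(2) sub])
    qed
    finally show ?thesis
      using char_sum_eq[of 2] card_Fq[of 1] by (simp add: sum_subtractf z_def D_def sum_distrib_left)
  qed
  have s11: "(\<Sum>p\<in>?P. int (n1 p) ^ 2) = int q * D + D ^ 2 - 2 * D + z"
  proof -
    have "n1 p ^ 2 = card {y \<in> ?P. ?on p (fst y) \<and> ?on p (snd y)}" for p
    proof -
      have "{y \<in> ?P. ?on p (fst y) \<and> ?on p (snd y)} = {x \<in> Fq 1. ?on p x} \<times> {x \<in> Fq 1. ?on p x}"
        by auto
      then show ?thesis by (simp only: card_cartesian_product n1_def power2_eq_square)
    qed
    then have "(\<Sum>p\<in>?P. int (n1 p) ^ 2) = (\<Sum>p\<in>?P. int (card {y \<in> ?P. ?on p (fst y) \<and> ?on p (snd y)}))"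
      by (simp flip: of_nat_power)
    also have "\<dots> = (\<Sum>y\<in>?P. int (card {p \<in> ?P. ?on p (fst y) \<and> ?on p (snd y)}))"
      using sum_card_swap[OF fin(3,3), of "\<lambda>p y. ?on p (fst y) \<and> ?on p (snd y)"]
      by (simp flip: of_nat_sum)
    also have "\<dots> = (\<Sum>x\<in>Fq 1. \<Sum>x'\<in>Fq 1. int (card {p \<in> ?P. ?on p x \<and> ?on p x'}))"
      by (simp add: sum.cartesian_product case_prod_beta)
    also have "\<dots> = (\<Sum>x\<in>Fq 1. \<Sum>x'\<in>Fq 1. R x * R x' + (if x' = x then int q * R x - R x ^ 2 else 0))"
      by (intro sum.cong refl) (use on1 on11 in \<open>auto simp: power2_eq_square\<close>)
    also have "\<dots> = (\<Sum>x\<in>Fq 1. R x * D + (int q * R x - (2 * R x - Z x)))"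
      using fin num_sqrts_cases(1)[OF f_in_Fq]
      by (intro sum.cong refl) (simp add: sum.distrib D_def R_def Z_def sum.delta sum_distrib_left)
    also have "\<dots> = D * D + (int q * D - (2 * D - z))"
      by (simp only: sum.distrib sum_subtractf sum_distrib_left[symmetric]
          sum_distrib_right[symmetric] D_def[symmetric] z_def[symmetric])
    finally show ?thesis by (simp add: power2_eq_square)
  qed
  have "(\<Sum>p\<in>?P. int (n2 p) + int (n1 p) ^ 2 + 2 * int (d1 p)) = (\<Sum>p\<in>?P. 4 * int (n1 p))"
  proof (rule sum.cong[OF refl])
    fix p assume "p \<in> ?P"
    from arg_cong[OF count[OF this], of int]
    show "int (n2 p) + int (n1 p) ^ 2 + 2 * int (d1 p) = 4 * int (n1 p)" by simp
  qed
  then have "int q * D + char_sum 2 + int q ^ 2 - 2 * int q + z + (int q * D + D ^ 2 - 2 * D + z) + 2 * (D - z)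
      = 4 * (int q * D)"
    by (simp only: sum.distrib sum_distrib_left[symmetric] s1 s2 s11 sd)
  then have "char_sum 2 = 2 * int q - (D - int q) ^ 2" by (simp add: power2_eq_square algebra_simps)
  moreover have "char_sum 1 = D - int q" using char_sum_eq[of 1] by (simp add: D_def R_def)
  ultimately show ?thesis by (simp only:)
qed

text \<open>
  Newton's identity for an $L$-polynomial $1 + S_1 t + q t^2$ of degree 2.
\<close>

lemma char_sum_recurrence:
  "n > 0 \<Longrightarrow> char_sum n = - lucas_v (- char_sum 1) (int q) n"
proof -
  have S1: "chi_sum 1 = char_sum 1" using newton_identity[of 1] chi_sum_0 by simp
  have "2 * chi_sum 2 = char_sum 1 * chi_sum 1 + char_sum 2"
    using newton_identity[of 2] chi_sum_0 by (simp add: numeral_2_eq_2)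
  then have S2: "chi_sum 2 = int q" using S1 char_sum_2 by (simp add: power2_eq_square)
  have rec: "char_sum (n + 3) = - char_sum 1 * char_sum (n + 2) - int q * char_sum (n + 1)" for n
  proof -
    have "(\<Sum>k=1..n+3. char_sum k * chi_sum (n + 3 - k)) = (\<Sum>k\<in>{n+1,n+2,n+3}. char_sum k * chi_sum (n + 3 - k))"
      using chi_sum_ge_3 by (intro sum.mono_neutral_right) auto
    then have "char_sum (n + 1) * chi_sum 2 + char_sum (n + 2) * chi_sum 1 + char_sum (n + 3) * chi_sum 0 = 0"
      using newton_identity[of "n + 3"] chi_sum_ge_3[of "n + 3"] by simp
    then show ?thesis using chi_sum_0 S1 S2 by (simp add: algebra_simps)
  qed
  show "n > 0 \<Longrightarrow> char_sum n = - lucas_v (- char_sum 1) (int q) n"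
  proof (induction n rule: less_induct)
    case (less n)
    have "n = 1 \<or> n = 2 \<or> (\<exists>k. n = k + 3)" using less.prems by presburger
    then show ?case
    proof (elim disjE exE)
      assume "n = 2" then show ?thesis using char_sum_2 by (simp add: numeral_2_eq_2 power2_eq_square)
    next
      fix k assume k: "n = k + 3"
      with less.IH[of "k + 1"] less.IH[of "k + 2"] rec[of k] show ?thesis
        by (simp add: numeral_3_eq_3 numeral_2_eq_2 algebra_simps)
    qed simp
  qed
qed

end

section \<open>Rational points of elliptic curves\<close>

lemma finite_field_power_card:
  fixes x :: "'a::{field,finite}"
  shows "x ^ CARD('a) = x"
proof (cases "x = 0")
  case False
  let ?U = "UNIV - {0 :: 'a}"
  have "(\<Prod>y\<in>?U. x * y) = (\<Prod>y\<in>?U. y)"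
    by (rule prod.reindex_bij_witness[where i = "\<lambda>y. y / x" and j = "\<lambda>y. x * y"])
      (use False in auto)
  then have "x ^ card ?U * (\<Prod>y\<in>?U. y) = (\<Prod>y\<in>?U. y)"
    by (simp add: prod.distrib)
  then have "x ^ card ?U = 1" by simp
  moreover have "CARD('a) = Suc (card ?U)"
    using card_Suc_Diff1[of UNIV "0 :: 'a"] by simp
  ultimately show ?thesis by (simp only: power_Suc mult_1_right)
qed (simp add: power_0_left)

lemma CHAR_prime_power_card:
  assumes "prime p" "CARD('a::{field,finite}) = p ^ r"
  shows "CHAR('a) = p"
proof -
  have "prime CHAR('a)"
    by (rule prime_CHAR_semidom) (simp add: finite_imp_CHAR_pos)
  moreover have "(\<Sum>x::'a\<in>UNIV. x + 1) = (\<Sum>x\<in>UNIV. x)"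
    by (rule sum.reindex_bij_witness[where i = "\<lambda>x. x - 1" and j = "\<lambda>x. x + 1"]) auto
  then have "of_nat (CARD('a)) = (0 :: 'a)" by (simp add: sum.distrib)
  then have "CHAR('a) dvd p ^ r" by (simp only: of_nat_eq_0_iff_char_dvd assms(2))
  ultimately show ?thesis using assms(1) by (metis prime_dvd_power primes_dvd_imp_eq)
qed

text \<open>
  The cubic in $(y + (a_1 x + a_3)/2)^2 = f(x)$.
\<close>

definition completed_cubic :: "'k::field weierstrass \<Rightarrow> 'k poly" where
  "completed_cubic E = [:wa6 E + (wa3 E / 2) ^ 2, wa4 E + 2 * (wa1 E / 2) * (wa3 E / 2),
     wa2 E + (wa1 E / 2) ^ 2, 1:]"

lemma weierstrass_form_affine:
  assumes "(2 :: 'k::field) \<noteq> 0"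
  shows "weierstrass_form E (x, y, 1 :: 'k) =
    (y + (wa1 E / 2 * x + wa3 E / 2)) ^ 2 - poly (completed_cubic E) x"
proof (cases E)
  case (Weierstrass a1 a2 a3 a4 a6)
  define b1 b3 where "b1 = a1 / 2" and "b3 = a3 / 2"
  then have "a1 = 2 * b1" "a3 = 2 * b3" using assms by (simp_all add: field_simps)
  then show ?thesis using assms
    by (simp add: Weierstrass completed_cubic_def algebra_simps power2_eq_square power3_eq_cube)
qed

text \<open>
  A multiple root \<open>x\<close> would make $(x, -(a_1 x + a_3)/2)$ a singular point. The partial derivative in
  \<open>Z\<close> is controlled by the other two through Euler's relation for forms of degree 3.
\<close>

lemma separable_completed_cubic:
  fixes E :: "'a::field weierstrass"
  assumes "elliptic_curve E" and two: "(2 :: 'a alg_closure) \<noteq> 0"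
    and root: "poly (completed_cubic (base_change E)) x = 0"
  shows "poly (pderiv (completed_cubic (base_change E))) x \<noteq> 0"
proof
  assume d: "poly (pderiv (completed_cubic (base_change E))) x = 0"
  obtain a1 a2 a3 a4 a6 where E: "base_change E = Weierstrass a1 a2 a3 a4 a6"
    by (cases "base_change E")
  define b1 b3 where "b1 = a1 / 2" and "b3 = a3 / 2"
  have a: "a1 = 2 * b1" "a3 = 2 * b3" using two by (simp_all add: b1_def b3_def field_simps)
  define y where "y = - (b1 * x + b3)"
  have form: "weierstrass_form (base_change E) (x, y, 1) = 0"
    unfolding weierstrass_form_affine[OF two] root by (simp add: E y_def b1_def b3_def)
  then have F: "y ^ 2 + a1 * x * y + a3 * y - (x ^ 3 + a2 * x ^ 2 + a4 * x + a6) = 0"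
    by (simp add: E)
  have "poly (pderiv (completed_cubic (base_change E))) x =
      3 * x ^ 2 + 2 * (a2 + b1 ^ 2) * x + (a4 + 2 * b1 * b3)"
    by (simp add: E completed_cubic_def pderiv_pCons b1_def b3_def algebra_simps power2_eq_square)
  moreover have "a1 * y - (3 * x ^ 2 + 2 * a2 * x + a4) =
      - (3 * x ^ 2 + 2 * (a2 + b1 ^ 2) * x + (a4 + 2 * b1 * b3))"
    by (simp add: a y_def algebra_simps power2_eq_square)
  ultimately have X: "a1 * y - (3 * x ^ 2 + 2 * a2 * x + a4) = 0"
    using d by (simp only: minus_zero)
  have Y: "2 * y + a1 * x + a3 = 0" by (simp add: a y_def algebra_simps)
  \<comment> \<open>Euler's relation \<open>3 F = x F_X + y F_Y + z F_Z\<close> at \<open>z = 1\<close>.\<close>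
  have "y ^ 2 + a1 * x * y + 2 * a3 * y - (a2 * x ^ 2 + 2 * a4 * x + 3 * a6) =
      3 * (y ^ 2 + a1 * x * y + a3 * y - (x ^ 3 + a2 * x ^ 2 + a4 * x + a6))
      - x * (a1 * y - (3 * x ^ 2 + 2 * a2 * x + a4)) - y * (2 * y + a1 * x + a3)"
    by (simp add: algebra_simps power2_eq_square power3_eq_cube)
  then have Z: "y ^ 2 + a1 * x * y + 2 * a3 * y - (a2 * x ^ 2 + 2 * a4 * x + 3 * a6) = 0"
    unfolding F X Y by simp
  have "weierstrass_gradient (base_change E) (x, y, 1) = (0, 0, 0)"
    using X Y Z by (simp add: E)
  with assms(1) form show False unfolding elliptic_curve_def by fastforce
qed

text \<open>
  The line at infinity $Z = 0$ meets the curve only in $[0:1:0]$.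
\<close>

lemma card_points_affine:
  fixes E :: "'a::{field,finite} weierstrass" and n :: nat
  defines "K \<equiv> (finite_ext n :: 'a alg_closure set)"
  assumes K0: "0 \<in> K" "1 \<in> K" and K: "\<And>x y. x \<in> K \<Longrightarrow> y \<in> K \<Longrightarrow> x / y \<in> K"
    and fin: "finite K"
  shows "card (points E n) =
    Suc (card {(x, y). x \<in> K \<and> y \<in> K \<and> weierstrass_form (base_change E) (x, y, 1) = 0})"
proof -
  let ?W = "weierstrass_form (base_change E)"
  let ?A = "{(x, y). x \<in> K \<and> y \<in> K \<and> ?W (x, y, 1) = 0}"
  let ?P = "\<lambda>(x, y). proj_point K (x, y, 1)"
  obtain a1 a2 a3 a4 a6 where E: "base_change E = Weierstrass a1 a2 a3 a4 a6"
    by (cases "base_change E")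
  have mem: "v \<in> proj_point K v" for v
    using K0 by (cases v) (auto simp: proj_point_def intro!: exI[of _ 1])
  have mult: "x * y \<in> K" if "x \<in> K" "y \<in> K" for x y
    using K[OF that(1) K[OF K0(2) that(2)]] by simp
  have scale: "proj_point K (c * x, c * y, c * z) = proj_point K (x, y, z)"
    if "c \<in> K" "c \<noteq> 0" for c x y z
  proof (intro equalityI subsetI)
    fix v assume "v \<in> proj_point K (c * x, c * y, c * z)"
    then obtain d where "d \<in> K" "d \<noteq> 0" "v = (d * (c * x), d * (c * y), d * (c * z))"
      by (auto simp: proj_point_def)
    then show "v \<in> proj_point K (x, y, z)"
      using that mult[of d c] by (auto simp: proj_point_def mult.assoc intro!: exI[of _ "d * c"])
  next
    fix v assume "v \<in> proj_point K (x, y, z)"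
    then obtain d where "d \<in> K" "d \<noteq> 0" "v = (d * x, d * y, d * z)"
      by (auto simp: proj_point_def)
    then show "v \<in> proj_point K (c * x, c * y, c * z)"
      using that K[of d c] by (auto simp: proj_point_def intro!: exI[of _ "d / c"])
  qed
  have hom: "?W (c * x, c * y, c * z) = c ^ 3 * ?W (x, y, z)" for c x y z
    by (simp add: E algebra_simps power2_eq_square power3_eq_cube)
  have "points E n = insert (proj_point K (0, 1, 0)) (?P ` ?A)"
  proof (intro equalityI subsetI)
    fix t assume "t \<in> points E n"
    then obtain x y z where t: "t = proj_point K (x, y, z)" and xyz: "x \<in> K" "y \<in> K" "z \<in> K"
      "(x, y, z) \<noteq> (0, 0, 0)" "?W (x, y, z) = 0"
      unfolding points_def K_def by blast
    show "t \<in> insert (proj_point K (0, 1, 0)) (?P ` ?A)"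
    proof (cases "z = 0")
      case True
      with xyz(5) have "x = 0" by (simp add: E)
      with True xyz have "t = proj_point K (0, 1, 0)"
        using scale[of y 0 1 0] by (simp add: t)
      then show ?thesis by blast
    next
      case False
      have "t = proj_point K (x / z, y / z, 1)"
        using scale[of z "x / z" "y / z" 1] False xyz by (simp add: t)
      moreover have "z ^ 3 * ?W (x / z, y / z, 1) = 0"
        using hom[of z "x / z" "y / z" 1] False xyz(5) by simp
      then have "(x / z, y / z) \<in> ?A" using False xyz K by simp
      ultimately have "t \<in> ?P ` ?A" by (intro image_eqI[of _ _ "(x / z, y / z)"]) simp_all
      then show ?thesis by blast
    qed
  next
    fix t assume "t \<in> insert (proj_point K (0, 1, 0)) (?P ` ?A)"
    then obtain v where "t = proj_point K v" "v \<in> K \<times> K \<times> K" "v \<noteq> (0, 0, 0)" "?W v = 0"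
      using K0 by (elim insertE imageE) (auto simp: E)
    then show "t \<in> points E n" unfolding points_def K_def by blast
  qed
  moreover have "proj_point K (0, 1, 0) \<notin> ?P ` ?A"
  proof
    assume "proj_point K (0, 1, 0) \<in> ?P ` ?A"
    then obtain x y where "proj_point K (0, 1, 0) = proj_point K (x, y, 1)" by auto
    with mem[of "(x, y, 1)"] have "(x, y, 1) \<in> proj_point K (0, 1, 0)" by simp
    then show False by (auto simp: proj_point_def)
  qed
  moreover have "inj_on ?P ?A"
  proof (rule inj_onI, clarify)
    fix x y x' y' assume "proj_point K (x, y, 1) = proj_point K (x', y', 1)"
    with mem[of "(x, y, 1)"] have "(x, y, 1) \<in> proj_point K (x', y', 1)" by simp
    then show "x = x' \<and> y = y'" by (auto simp: proj_point_def)
  qed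
  moreover have "finite ?A"
    by (rule finite_subset[of _ "K \<times> K"]) (use fin in auto)
  ultimately show ?thesis by (simp add: card_image)
qed

text \<open>
  The point at infinity accounts for 1, the abscissas for $q^k$, and the character sum for the
  remaining term $-(\alpha^k + \beta^k)$.
\<close>

lemma card_points_elliptic_curve:
  fixes E :: "'a::{field,finite} weierstrass"
  assumes "prime p" "odd p" "l \<ge> 1" "CARD('a) = p ^ l" "elliptic_curve E" "k \<ge> 1"
  shows "int (card (points E k)) = 1 + int CARD('a) ^ k -
    lucas_v (1 + int CARD('a) - int (card (points E 1))) (int CARD('a)) k"
proof -
  let ?q = "CARD('a)"
  let ?B = "base_change E"
  let ?f = "completed_cubic ?B"
  have char: "CHAR('a alg_closure) = p"
    using CHAR_prime_power_card[OF assms(1,4)] by simp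
  have odd: "odd ?q" using assms(2,4) by simp
  have gt: "?q > 1" using assms(1,3,4) one_less_power[OF prime_gt_1_nat[OF assms(1)], of l] by simp
  have char_dvd: "CHAR('a alg_closure) dvd ?q" using assms(3,4) char by simp
  have add: "(x + y) ^ ?q = x ^ ?q + y ^ ?q" for x y :: "'a alg_closure"
    using freshmans_dream'[of ?q l x y] assms(1,4) char by simp
  have two: "(2 :: 'a alg_closure) \<noteq> 0"
  proof
    assume "(2 :: 'a alg_closure) = 0"
    then have "of_nat 2 = (0 :: 'a alg_closure)" by simp
    then have "p dvd 2" by (simp only: of_nat_eq_0_iff_char_dvd char)
    then have "p \<le> 2" by (rule dvd_imp_le) simp
    with assms(1,2) show False using prime_gt_1_nat[of p] by (metis dvd_refl le_antisym Suc_leI Suc_1)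
  qed
  then have two': "(2 :: 'a) \<noteq> 0" by (metis to_ac_0 to_ac_numeral)
  have rational: "map_poly (\<lambda>x. x ^ ?q) ?f = ?f"
  proof (rule poly_eqI)
    fix i
    have "coeff ?f i = to_ac (coeff (completed_cubic E) i)"
      using two two' by (cases E) (simp add: completed_cubic_def coeff_pCons split: nat.split)
    then show "coeff (map_poly (\<lambda>x. x ^ ?q) ?f) i = coeff ?f i"
      using gt finite_field_power_card[of "coeff (completed_cubic E) i"]
      by (simp add: coeff_map_poly flip: to_ac_power)
  qed
  interpret cubic_over_finite ?q ?f
    by unfold_locales
      (use odd gt add char_dvd rational separable_completed_cubic[OF assms(5) two] in
        \<open>simp_all add: of_nat_eq_0_iff_char_dvd\<close>, simp_all add: completed_cubic_def)
  have Fq: "finite_ext n = Fq n" for n by (simp add: finite_ext_def Fq_def)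
  have count: "int (card (points E n)) = 1 + int ?q ^ n + char_sum n" if n: "n \<ge> 1" for n
  proof -
    let ?h = "\<lambda>x. wa1 ?B / 2 * x + wa3 ?B / 2"
    have in1: "to_ac c \<in> Fq n" for c :: 'a
    proof -
      have "to_ac c \<in> Fq 1"
        using finite_field_power_card[of c] by (simp add: Fq_def flip: to_ac_power)
      then show ?thesis by (rule Fq_1_subset)
    qed
    have "2 \<in> Fq n" using Fq_closed(3)[OF Fq_closed(2) Fq_closed(2)] by simp
    moreover have "wa1 ?B \<in> Fq n" "wa3 ?B \<in> Fq n" using in1 by (cases E; simp)+
    ultimately have h_Fq: "?h x \<in> Fq n" if "x \<in> Fq n" for x
      using that by (intro Fq_closed(3,5,6))
    \<comment> \<open>Kept opaque, so that rewriting does not take the shift apart.\<close>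
    define h where "h = ?h"
    have form: "weierstrass_form ?B (x, y, 1) = (y + h x) ^ 2 - poly ?f x" for x y
      unfolding h_def by (rule weierstrass_form_affine[OF two])
    have plus: "y + h x \<in> Fq n" and minus: "y - h x \<in> Fq n" if "x \<in> Fq n" "y \<in> Fq n" for x y
      unfolding h_def using that h_Fq by (simp_all only: Fq_closed(3,4))
    have "bij_betw (\<lambda>(x, y). (x, y + h x))
        {(x, y). x \<in> Fq n \<and> y \<in> Fq n \<and> weierstrass_form ?B (x, y, 1) = 0}
        (SIGMA x:Fq n. {y \<in> Fq n. y ^ 2 = poly ?f x})"
      by (rule bij_betw_byWitness[where f' = "\<lambda>(x, y). (x, y - h x)"])
        (auto simp: form plus minus)
    then have "card {(x, y). x \<in> Fq n \<and> y \<in> Fq n \<and> weierstrass_form ?B (x, y, 1) = 0}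
        = card (SIGMA x:Fq n. {y \<in> Fq n. y ^ 2 = poly ?f x})" by (rule bij_betw_same_card)
    also have "\<dots> = (\<Sum>x\<in>Fq n. num_sqrts n (poly ?f x))"
      using finite_Fq[of n] n by (subst card_SigmaI) (auto simp: num_sqrts_def)
    finally have "card (points E n) = Suc (\<Sum>x\<in>Fq n. num_sqrts n (poly ?f x))"
      using card_points_affine[where E = E and n = n, unfolded Fq,
          OF Fq_closed(1) Fq_closed(2) Fq_closed(6) finite_Fq] n by simp
    then show ?thesis using char_sum_eq[of n] n by simp
  qed
  have "1 + int ?q - int (card (points E 1)) = - char_sum 1" using count[of 1] by simp
  then show ?thesis using count[OF assms(6)] char_sum_recurrence[of k] assms(6) by simp
qed


section \<open>The parities for genus one\<close>

lemma even_half_iff: "even ((x::int) div 2) \<longleftrightarrow> x mod 4 = 0 \<or> x mod 4 = 1"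
  by presburger

lemma even_triangular:
  fixes a :: int
  shows "even (a * (a + 1) div 2) \<longleftrightarrow> a mod 4 = 0 \<or> a mod 4 = 3"
    and "even (a * (a - 1) div 2) \<longleftrightarrow> a mod 4 = 0 \<or> a mod 4 = 1"
proof -
  have "(a * (a + 1)) mod 4 = ((a mod 4) * (a mod 4 + 1)) mod 4"
    "(a * (a - 1)) mod 4 = ((a mod 4) * (a mod 4 - 1)) mod 4"
    by (intro mod_mult_cong; simp add: mod_simps)+
  moreover have "a mod 4 = 0 \<or> a mod 4 = 1 \<or> a mod 4 = 2 \<or> a mod 4 = 3" by presburger
  ultimately show "even (a * (a + 1) div 2) \<longleftrightarrow> a mod 4 = 0 \<or> a mod 4 = 3"
    "even (a * (a - 1) div 2) \<longleftrightarrow> a mod 4 = 0 \<or> a mod 4 = 1"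
    unfolding even_half_iff by (elim disjE; simp)+
qed

lemma odd_part_exists: "m \<ge> 1 \<Longrightarrow> \<exists>s n. m = 2 ^ s * n \<and> odd (n :: nat)"
proof (induction m rule: less_induct)
  case (less m)
  show ?case
  proof (cases "odd m")
    case True
    then show ?thesis by (intro exI[of _ 0] exI[of _ m]) simp
  next
    case False
    then obtain l where l: "m = 2 * l" by auto
    with less.prems less.IH[of l] obtain s n where "l = 2 ^ s * n" "odd n" by auto
    then show ?thesis by (intro exI[of _ "Suc s"] exI[of _ n]) (simp add: l)
  qed
qed

lemma small_or_plus_5: "(k::nat) = 0 \<or> k = 1 \<or> k = 2 \<or> k = 3 \<or> k = 4 \<or> (\<exists>j. k = j + 5)"
  by presburger

lemma lucas_parity_small:
  "lucas_parity a q 2 = a * (a + 1) div 2 + q"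
  "lucas_parity a q 3 = a * a + a * q"
  "lucas_parity a q 4 = a * (a * (a + 1) div 2 + q) + q * (q - 1) div 2"
  "lucas_parity a q (j + 5) = a * lucas_parity a q (j + 3) + q * lucas_parity a q (j + 1)"
  by (simp_all add: eval_nat_numeral)

lemma lucas_v_0: "k \<ge> 1 \<Longrightarrow> lucas_v c 0 k = c ^ k"
proof (induction k)
  case (Suc k) then show ?case by (cases k) auto
qed simp

lemma lucas_parity_0:
  assumes "odd c" "k \<ge> 1"
  shows "odd (lucas_parity c 0 k) \<longleftrightarrow> odd k \<or> odd (c * (c + 1) div 2)"
  using assms(2)
proof (induction k rule: less_induct)
  case (less k)
  from small_or_plus_5[of k] show ?case
  proof (elim disjE exE)
    fix j assume j: "k = j + 5"
    then have "lucas_parity c 0 k = c * lucas_parity c 0 (j + 3)" by (simp add: lucas_parity_small)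
    with less.IH[of "j + 3"] assms(1) j show ?thesis by simp
  qed (use less.prems assms(1) in \<open>auto simp: lucas_parity_small\<close>)
qed

lemma lucas_parity_even:
  assumes "even a" "odd q" "k \<ge> 1"
  shows "odd (lucas_parity a q k) \<longleftrightarrow>
    k mod 4 = 2 \<and> even (a * (a + 1) div 2) \<or> k mod 4 = 0 \<and> odd (q * (q - 1) div 2)"
  using assms(3)
proof (induction k rule: less_induct)
  case (less k)
  from small_or_plus_5[of k] show ?case
  proof (elim disjE exE)
    fix j assume j: "k = j + 5"
    have "lucas_parity a q k = a * lucas_parity a q (j + 3) + q * lucas_parity a q (j + 1)"
      unfolding j by (rule lucas_parity_small(4))
    moreover have "k mod 4 = (j + 1) mod 4" unfolding j by presburger
    ultimately show ?thesis using less.IH[of "j + 1"] assms(1,2) j by simp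
  qed (use less.prems assms(1,2) in \<open>auto simp: lucas_parity_small\<close>)
qed

text \<open>
  With \<open>s\<close> the parity of $a(a+1)/2 + 1$ and \<open>t\<close> that of $q(q-1)/2$, the even indices carry the
  Fibonacci pattern $s, s + t, t$ modulo 2 and the odd indices the pattern $1, 0, 1$.
\<close>

definition lucas_parity_mod_6 :: "bool \<Rightarrow> bool \<Rightarrow> nat \<Rightarrow> bool" where
  "lucas_parity_mod_6 s t i \<longleftrightarrow> i = 1 \<or> i = 5 \<or> i = 2 \<and> s \<or> i = 4 \<and> s \<noteq> t \<or> i = 0 \<and> t"

lemma lucas_parity_odd:
  assumes "odd a" "odd q" "k \<ge> 1"
  shows "odd (lucas_parity a q k) \<longleftrightarrow>
    lucas_parity_mod_6 (even (a * (a + 1) div 2)) (odd (q * (q - 1) div 2)) (k mod 6)"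
  using assms(3)
proof (induction k rule: less_induct)
  case (less k)
  from small_or_plus_5[of k] show ?case
  proof (elim disjE exE)
    fix j assume j: "k = j + 5"
    have "lucas_parity a q k = a * lucas_parity a q (j + 3) + q * lucas_parity a q (j + 1)"
      unfolding j by (rule lucas_parity_small(4))
    then have odd: "odd (lucas_parity a q k) \<longleftrightarrow>
        odd (lucas_parity a q (j + 3)) \<noteq> odd (lucas_parity a q (j + 1))"
      using assms(1,2) by simp
    have mod: "(j + 3) mod 6 = (j mod 6 + 3) mod 6" "(j + 1) mod 6 = (j mod 6 + 1) mod 6"
      "k mod 6 = (j mod 6 + 5) mod 6" unfolding j by (simp_all add: mod_simps)
    have "j mod 6 = 0 \<or> j mod 6 = 1 \<or> j mod 6 = 2 \<or> j mod 6 = 3 \<or> j mod 6 = 4 \<or> j mod 6 = 5"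
      by presburger
    moreover have "odd (lucas_parity a q (j + 3)) \<longleftrightarrow> lucas_parity_mod_6
        (even (a * (a + 1) div 2)) (odd (q * (q - 1) div 2)) ((j + 3) mod 6)"
      "odd (lucas_parity a q (j + 1)) \<longleftrightarrow> lucas_parity_mod_6
        (even (a * (a + 1) div 2)) (odd (q * (q - 1) div 2)) ((j + 1) mod 6)"
      using less.IH[of "j + 3"] less.IH[of "j + 1"] j by auto
    ultimately show ?thesis unfolding odd mod
      by (elim disjE) (auto simp: lucas_parity_mod_6_def)
  qed (use less.prems assms(1,2) in
    \<open>auto simp: lucas_parity_mod_6_def lucas_parity_small\<close>)
qed

text \<open>
  Exponents of $Z = (1 - at + qt^2)/((1 - t)(1 - qt))$ are obtained by combining those of the three
  factors. Signs do not matter for parities.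
\<close>

lemma euler_exponents_of_genus_1_counts:
  fixes a :: int and q m :: nat
  obtains M where
    "\<And>k. 1 \<le> k \<Longrightarrow> k \<le> m \<Longrightarrow> (\<Sum>i | i dvd k. int i * M i) = 1 + int q ^ k - lucas_v a (int q) k"
    "\<And>k. 1 \<le> k \<Longrightarrow> k \<le> m \<Longrightarrow> even (\<Sum>i | i dvd k. M i) \<longleftrightarrow>
       even (lucas_parity 1 0 k + lucas_parity (int q) 0 k + lucas_parity a (int q) k)"
proof -
  obtain L where L: "\<And>k. 1 \<le> k \<and> k \<le> m \<Longrightarrow> (\<Sum>i | i dvd k. int i * L i) = - lucas_v 1 0 k
      \<and> (even (\<Sum>i | i dvd k. L i) \<longleftrightarrow> even (lucas_parity 1 0 k))"
    using lucas_exponents by blast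
  obtain L' where L': "\<And>k. 1 \<le> k \<and> k \<le> m \<Longrightarrow> (\<Sum>i | i dvd k. int i * L' i) = - lucas_v (int q) 0 k
      \<and> (even (\<Sum>i | i dvd k. L' i) \<longleftrightarrow> even (lucas_parity (int q) 0 k))"
    using lucas_exponents by blast
  obtain L'' where L'': "\<And>k. 1 \<le> k \<and> k \<le> m \<Longrightarrow> (\<Sum>i | i dvd k. int i * L'' i) = - lucas_v a (int q) k
      \<and> (even (\<Sum>i | i dvd k. L'' i) \<longleftrightarrow> even (lucas_parity a (int q) k))"
    using lucas_exponents by blast
  show thesis
  proof (rule that[of "\<lambda>i. L'' i - L i - L' i"])
    fix k assume "1 \<le> k" "k \<le> m"
    with L[of k] L'[of k] L''[of k]
    show "(\<Sum>i | i dvd k. int i * (L'' i - L i - L' i)) = 1 + int q ^ k - lucas_v a (int q) k"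
      "even (\<Sum>i | i dvd k. L'' i - L i - L' i) \<longleftrightarrow>
         even (lucas_parity 1 0 k + lucas_parity (int q) 0 k + lucas_parity a (int q) k)"
      by (auto simp: right_diff_distrib sum_subtractf lucas_v_0)
  qed
qed


theorem proposition3p2:
  fixes E :: "'a::{field,finite} weierstrass"
    and p r q m :: nat
    and a :: int
  assumes "prime p" and "odd p" and "r \<ge> 1" and "q = p ^ r"
    and "CARD('a) = q"
    and "elliptic_curve E"
    and "a = 1 + int q - int (card (points E 1))"
    and "m \<ge> 1"
  shows
    "let e = gw_eps_component (fps_nth (dlog_zeta_A1_curve E) (m - 1)) in
     (a mod 4 = 0 \<and> q mod 4 = 1 \<longrightarrow> (e = 1 \<longleftrightarrow> m \<in> {4 * k + 2 | k. True})) \<and>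
     (a mod 4 = 0 \<and> q mod 4 = 3 \<longrightarrow> e = 0) \<and>
     (a mod 4 = 1 \<and> q mod 4 = 1 \<longrightarrow>
        (e = 1 \<longleftrightarrow> m \<in> {6 * k + 2 | k. True} \<union> {6 * k + 4 | k. True})) \<and>
     (a mod 4 = 1 \<and> q mod 4 = 3 \<longrightarrow> (e = 1 \<longleftrightarrow> m \<in> {6 * k + 4 | k. True})) \<and>
     (a mod 4 = 2 \<and> q mod 4 = 1 \<longrightarrow> e = 0) \<and>
     (a mod 4 = 2 \<and> q mod 4 = 3 \<longrightarrow> (e = 1 \<longleftrightarrow> m \<in> {4 * k + 2 | k. True})) \<and>
     (a mod 4 = 3 \<and> q mod 4 = 1 \<longrightarrow> e = 0) \<and>
     (a mod 4 = 3 \<and> q mod 4 = 3 \<longrightarrow> (e = 1 \<longleftrightarrow> m \<in> {6 * k + 2 | k. True}))"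
proof -
  define e where "e = gw_eps_component (fps_nth (dlog_zeta_A1_curve E) (m - 1))"
  let ?N = "\<lambda>n. card (points E n)"
  have q: "odd (int q)" using assms(2,4) by simp
  have N: "int (?N k) = 1 + int q ^ k - lucas_v a (int q) k" if "k \<ge> 1" for k
    using card_points_elliptic_curve[OF assms(1,2,3) _ assms(6) that] assms(4,5,7) by simp
  obtain M where M:
    "\<And>k. 1 \<le> k \<Longrightarrow> k \<le> m \<Longrightarrow> (\<Sum>i | i dvd k. int i * M i) = 1 + int q ^ k - lucas_v a (int q) k"
    "\<And>k. 1 \<le> k \<Longrightarrow> k \<le> m \<Longrightarrow> even (\<Sum>i | i dvd k. M i) \<longleftrightarrow>
       even (lucas_parity 1 0 k + lucas_parity (int q) 0 k + lucas_parity a (int q) k)"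
    using euler_exponents_of_genus_1_counts by blast
  have div: "1 \<le> k \<and> k \<le> m" if "k dvd m" for k
    using that assms(8) dvd_imp_le[of k m] by (auto intro!: Suc_leI Nat.gr0I)
  have closed: "closed_points ?N i = M i" if "i dvd m" for i
  proof (rule closed_points_eq)
    show "i > 0" using div[OF that] by simp
    fix k assume "k dvd i"
    from div[OF dvd_trans[OF this that]] show "(\<Sum>i | i dvd k. int i * M i) = int (?N k)"
      using M(1) N by simp
  qed
  have "(\<Sum>i | i dvd m \<and> even i. closed_points ?N i) = (\<Sum>i | i dvd m \<and> even i. M i)"
    using closed by (intro sum.cong refl) simp
  then have e: "e = of_bool (odd (\<Sum>i | i dvd m \<and> even i. M i))"
    unfolding e_def dlog_zeta_A1_curve_def gw_eps_component_dlog_zeta[OF assms(8)] by (simp only:)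
  define A where "A = even (a * (a + 1) div 2)"
  define R where "R = odd (int q * (int q - 1) div 2)"
  have R': "odd (int q * (int q + 1) div 2) \<longleftrightarrow> \<not> R"
  proof -
    have "int q * (int q + 1) = int q * (int q - 1) + 2 * int q" by (simp add: algebra_simps)
    then have "int q * (int q + 1) div 2 = int q * (int q - 1) div 2 + int q" by simp
    with q show ?thesis by (simp add: R_def)
  qed
  have B: "odd (\<Sum>i | i dvd k. M i) \<longleftrightarrow> (odd (lucas_parity a (int q) k) \<noteq> (even k \<and> R))"
    if "1 \<le> k" "k \<le> m" for k
    using M(2)[OF that] lucas_parity_0[of 1 k] lucas_parity_0[OF q that(1)] that R' by auto
  have e_odd: "e = 0" if "odd m"
  proof -
    have "{i. i dvd m \<and> even i} = {}" using that by (auto dest: dvd_trans)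
    then show ?thesis by (simp only: e sum.empty) simp
  qed
  have e_even: "e = of_bool ((odd (lucas_parity a (int q) m) \<noteq> R) \<noteq> (odd a \<and> m mod 6 \<noteq> 0))"
    if "even m"
  proof -
    \<comment> \<open>The odd divisors of \<open>m\<close> are the divisors of its odd part \<open>n\<close>.\<close>
    obtain s n where n: "m = 2 ^ s * n" "odd n" using odd_part_exists[OF assms(8)] by blast
    have odd_dvd: "i dvd m \<longleftrightarrow> i dvd n" if "odd i" for i
      using that unfolding n(1) by (intro coprime_dvd_mult_right_iff) simp
    have "{i. i dvd m \<and> odd i} = {i. i dvd n}"
      using odd_dvd n(2) by (auto dest: dvd_trans)
    moreover have fin: "finite {i. i dvd m}" using assms(8) by simp
    have "(\<Sum>i | i dvd m. M i) = (\<Sum>i | i dvd m \<and> even i. M i) + (\<Sum>i | i dvd m \<and> odd i. M i)"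
      using sum.Int_Diff[OF fin, of M "{i. even i}"] by (simp add: Int_def set_diff_eq)
    ultimately have "odd (\<Sum>i | i dvd m \<and> even i. M i) \<longleftrightarrow>
        odd (\<Sum>i | i dvd m. M i) \<noteq> odd (\<Sum>i | i dvd n. M i)" by auto
    moreover have n1: "1 \<le> n" "n \<le> m" using div[of n] n(1) by simp_all
    moreover have "odd (lucas_parity a (int q) n) \<longleftrightarrow> odd a \<and> m mod 6 \<noteq> 0"
    proof (cases "odd a")
      case True
      have "m mod 6 = 0 \<longleftrightarrow> n mod 6 = 3"
      proof -
        have "m mod 6 = 0 \<longleftrightarrow> 3 dvd m" using that by presburger
        also have "\<dots> \<longleftrightarrow> 3 dvd n" by (rule odd_dvd) simp
        also have "\<dots> \<longleftrightarrow> n mod 6 = 3" using n(2) by presburger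
        finally show ?thesis .
      qed
      moreover have "n mod 6 = 1 \<or> n mod 6 = 3 \<or> n mod 6 = 5" using n(2) by presburger
      ultimately show ?thesis
        using lucas_parity_odd[OF True q n1(1)] True by (auto simp: lucas_parity_mod_6_def)
    next
      case False
      moreover have "n mod 4 \<noteq> 0" "n mod 4 \<noteq> 2" using n(2) by presburger+
      ultimately show ?thesis using lucas_parity_even[OF _ q n1(1), of a] by simp
    qed
    ultimately show ?thesis using B[of m] B[of n] assms(8) n(2) that by (simp add: e)
  qed
  have m4: "m \<in> {4 * k + 2 | k. True} \<longleftrightarrow> m mod 4 = 2" by simp presburger
  have m6: "m \<in> {6 * k + 2 | k. True} \<longleftrightarrow> m mod 6 = 2"
    "m \<in> {6 * k + 4 | k. True} \<longleftrightarrow> m mod 6 = 4" by (simp; presburger)+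
  have R: "q mod 4 = 1 \<Longrightarrow> \<not> R" "q mod 4 = 3 \<Longrightarrow> R"
  proof -
    have "int q mod 4 = int (q mod 4)" by (simp add: zmod_int)
    then show "q mod 4 = 1 \<Longrightarrow> \<not> R" "q mod 4 = 3 \<Longrightarrow> R"
      unfolding R_def even_triangular by simp_all
  qed
  have A: "A \<longleftrightarrow> a mod 4 = 0 \<or> a mod 4 = 3" unfolding A_def by (rule even_triangular)
  have parity: "a mod 4 = 0 \<Longrightarrow> even a" "a mod 4 = 1 \<Longrightarrow> odd a" "a mod 4 = 2 \<Longrightarrow> even a"
    "a mod 4 = 3 \<Longrightarrow> odd a" by presburger+
  have e_a_even: "e = of_bool (even m \<and> ((m mod 4 = 2 \<and> A \<or> m mod 4 = 0 \<and> R) \<noteq> R))" if "even a"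
    using e_odd e_even lucas_parity_even[OF that q assms(8)] that
    by (cases "even m") (simp_all add: A_def R_def)
  have e_a_odd: "e = of_bool (even m \<and>
      ((lucas_parity_mod_6 A R (m mod 6) \<noteq> R) \<noteq> (m mod 6 \<noteq> 0)))" if "odd a"
    using e_odd e_even lucas_parity_odd[OF that q assms(8)] that
    by (cases "even m") (simp_all add: A_def R_def)
  have even4: "even m \<longleftrightarrow> m mod 4 = 0 \<or> m mod 4 = 2" by presburger
  have even6: "even m \<longleftrightarrow> m mod 6 = 0 \<or> m mod 6 = 2 \<or> m mod 6 = 4" by presburger
  have even_cases: "a mod 4 = 0 \<Longrightarrow> q mod 4 = 1 \<Longrightarrow> e = 1 \<longleftrightarrow> m mod 4 = 2"
    "a mod 4 = 0 \<Longrightarrow> q mod 4 = 3 \<Longrightarrow> e = 0"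
    "a mod 4 = 2 \<Longrightarrow> q mod 4 = 1 \<Longrightarrow> e = 0"
    "a mod 4 = 2 \<Longrightarrow> q mod 4 = 3 \<Longrightarrow> e = 1 \<longleftrightarrow> m mod 4 = 2"
    using e_a_even[unfolded even4] parity R A by auto
  have odd_cases: "a mod 4 = 1 \<Longrightarrow> q mod 4 = 1 \<Longrightarrow> e = 1 \<longleftrightarrow> m mod 6 = 2 \<or> m mod 6 = 4"
    "a mod 4 = 1 \<Longrightarrow> q mod 4 = 3 \<Longrightarrow> e = 1 \<longleftrightarrow> m mod 6 = 4"
    "a mod 4 = 3 \<Longrightarrow> q mod 4 = 1 \<Longrightarrow> e = 0"
    "a mod 4 = 3 \<Longrightarrow> q mod 4 = 3 \<Longrightarrow> e = 1 \<longleftrightarrow> m mod 6 = 2"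
    using e_a_odd[unfolded even6] parity R A by (auto simp: lucas_parity_mod_6_def)
  show ?thesis
    unfolding Let_def e_def[symmetric] Un_iff m4 m6 using even_cases odd_cases by simp
qed

end
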